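(* Let $r$ be a positive integer and let $\alpha\in[1,12r/7]$ be fixed. For every $\varepsilon>0$ there exist constants $C=C(r,\alpha,\varepsilon)>0$ and $p_0=p_0(r,\alpha,\varepsilon)$ such that for every prime $p\ge p_0$ and every interval $\mathcal{J}\subseteq\mathbb{F}_p^*$ of length $N$ with $1\le N\le p^{1-1/r}$, $$\sum_{\lambda\in\mathbb{F}_p^*}\Bigl|\sum_{n\in\mathcal{J}}\mathcal{K}_p(\lambda,n)\Bigr|^{2\alpha}\le C\,p^{2\alpha+\varepsilon}\,N^{(12r-7\alpha)/(12r-7)}\left(1+\frac{N^2}{p^{1-1/r}}\right)^{7(\alpha-1)/(12r-7)}.$$
   Context: $\mathbf{e}_p(z)=\exp(2\pi i z/p)$, and the Kloosterman sum is $\mathcal{K}_p(m,n)=\sum_{x\in\mathbb{F}_p^*}\mathbf{e}_p(mx+nx^{-1})$, with $x^{-1}$ the inverse of $x$ in $\mathbb{F}_p^*$. $\mathbb{F}_p$ is identified with $\{0,1,\dots,p-1\}$; an interval in $\mathbb{F}_p$ of length $N$ is the set of residues modulo $p$ of $N$ consecutive integers $N_0+1,\dots,N_0+N$. The paper's notation $f\ll p^{o(1)}g$ means: for every $\varepsilon>0$ there is a constant $C_\varepsilon$ with $|f|\le C_\varepsilon p^\varepsilon g$ for all sufficiently large $p$; this has been written out in the claim. *)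

theory Defs
  imports "HOL-Analysis.Analysis" "HOL-Number_Theory.Number_Theory"
begin

text \<open>
  The field with \<open>p\<close> elements is identified with the integers \<open>0, \<dots>, p - 1\<close>; its nonzero
  elements are therefore \<open>1, \<dots>, p - 1\<close>.
\<close>

definition Fp_star :: "nat \<Rightarrow> int set" where
  "Fp_star p = {1..int p - 1}"

definition e_p :: "nat \<Rightarrow> int \<Rightarrow> complex" where
  "e_p p z = exp (2 * complex_of_real pi * \<i> * of_int z / of_nat p)"

definition Kloosterman :: "nat \<Rightarrow> int \<Rightarrow> int \<Rightarrow> complex" where
  "Kloosterman p m n = (\<Sum>x\<in>Fp_star p. e_p p (m * x + n * modular_inverse (int p) x))"

text \<open>
  The residues of \<open>N\<close> consecutive integers. The block \<open>N\<^sub>0 + 1, \<dots>, N\<^sub>0 + N\<close> may contain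
  multiples of \<open>p\<close>, so an interval may wrap around. The residues are pairwise distinct,
  so that the set has exactly \<open>N\<close> elements, if and only if \<open>N \<le> p\<close> (for \<open>p > 0\<close>).
\<close>

definition interval_mod :: "nat \<Rightarrow> nat \<Rightarrow> int set \<Rightarrow> bool" where
  "interval_mod p N J \<longleftrightarrow> (\<exists>N\<^sub>0 :: int. J = (\<lambda>k. k mod int p) ` {N\<^sub>0 + 1..N\<^sub>0 + int N})"

end

theory Submission
  imports Defs
begin

text \<open>
  Replacing \<open>x\<close> by its inverse \<open>\<sigma> y\<close> turns the average over \<open>\<J>\<close> into
  \<open>\<Sum>\<^sub>y G(y) e(\<lambda> \<sigma> y / p)\<close>, where \<open>G(y)\<close> is a geometric sum with \<open>\<bar>G(\<plusminus>y)\<bar> \<le> min N (p / y)\<close> for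
  \<open>1 \<le> y < p / 2\<close>. Three bounds suffice: the second moment is at most \<open>p\<^sup>2 N\<close> (Parseval), the sum
  itself is \<open>O(p log p)\<close>, and the moment of order \<open>2r\<close> is
  \<open>O(p\<^bsup>2r + o(1)\<^esup> (1 + N\<^sup>2 / p\<^bsup>1 - 1/r\<^esup>))\<close>. Since \<open>24r/7 \<ge> 2r\<close>, the last two bound the moment of order
  \<open>24r/7\<close>, and interpolation between the orders \<open>2\<close> and \<open>24r/7\<close> gives the claim.

  For the moment of order \<open>2r\<close>, a dyadic decomposition of the range of \<open>y\<close> leaves sums over \<open>u \<le> K\<close> with
  arbitrary coefficients bounded by one. These are averaged over the shifts \<open>u = v + ab\<close> with
  \<open>b < B = p\<^bsup>1/r\<^esup>\<close>, \<open>a \<le> A\<close>, \<open>AB \<le> K\<close>. As \<open>v + ab = a (s + b)\<close> with \<open>s = v / a\<close> modulo \<open>p\<close>, the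
  inner moment counts solutions of an equation between sums of \<open>r\<close> reciprocals of the numbers \<open>s + b\<close>; for
  a given non-diagonal choice of the \<open>b\<close>s it is a nonzero polynomial equation for \<open>s\<close> of degree less than
  \<open>2r\<close>. As \<open>2KA < p\<close>, a fraction \<open>v / a\<close> modulo \<open>p\<close> determines \<open>v\<close> and \<open>a\<close> up to their greatest common
  divisor, so using it as the weight in Hoelder's inequality costs only logarithms. No bound for
  individual Kloosterman sums is needed.
\<close>

section \<open>Additive characters\<close>

lemma e_p_eq_cis: "e_p p z = cis (2 * pi * of_int z / real p)"
  unfolding e_p_def cis_conv_exp by (simp add: mult_ac)

lemma norm_e_p [simp]: "norm (e_p p z) = 1"
  by (simp add: e_p_eq_cis)

lemma e_p_add: "e_p p (x + y) = e_p p x * e_p p y"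
  by (simp add: e_p_eq_cis cis_mult add_divide_distrib ring_distribs)

lemma e_p_0 [simp]: "e_p p 0 = 1"
  by (simp add: e_p_eq_cis)

lemma e_p_minus: "e_p p (- x) = cnj (e_p p x)"
  by (simp add: e_p_eq_cis cis_cnj)

lemma e_p_power: "e_p p x ^ n = e_p p (int n * x)"
  by (simp add: e_p_eq_cis Complex.DeMoivre mult_ac)

lemma e_p_sum: "e_p p (\<Sum>i\<in>I. f i) = (\<Prod>i\<in>I. e_p p (f i))"
  by (induction I rule: infinite_finite_induct) (auto simp: e_p_add)

lemma e_p_eq_1_iff:
  assumes "p > 0"
  shows "e_p p z = 1 \<longleftrightarrow> int p dvd z"
proof
  assume "e_p p z = 1"
  then have "cos (2 * pi * of_int z / real p) = 1"
    by (simp add: e_p_eq_cis complex_eq_iff)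
  then obtain k :: int where k: "2 * pi * of_int z / real p = of_int k * 2 * pi"
    by (auto simp: cos_one_2pi_int)
  then have "real_of_int z = of_int k * real p"
    using assms by (simp add: field_simps)
  then have "z = k * int p"
    by (metis of_int_eq_iff of_int_mult of_int_of_nat_eq)
  then show "int p dvd z" by simp
next
  assume "int p dvd z"
  then obtain k where k: "z = int p * k" by auto
  have "2 * pi * of_int z / real p = 2 * pi * of_int k"
    using assms by (simp add: k)
  then show "e_p p z = 1"
    unfolding e_p_eq_cis by simp
qed

lemma e_p_cong:
  assumes "p > 0" "[x = y] (mod int p)"
  shows "e_p p x = e_p p y"
proof -
  have "int p dvd x - y"
    using assms(2) by (simp add: cong_iff_dvd_diff)
  then have "e_p p (x - y) = 1"
    using assms(1) by (simp add: e_p_eq_1_iff)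
  then show ?thesis
    using e_p_add[of p "x - y" y] by simp
qed

section \<open>Orthogonality of additive characters and Parseval's identity\<close>

lemma sum_e_p:
  assumes "p > 0"
  shows "(\<Sum>t\<in>{0..<int p}. e_p p (t * z)) = (if int p dvd z then of_nat p else 0)"
proof -
  have "(\<Sum>t\<in>{0..<int p}. e_p p (t * z)) = (\<Sum>n<p. e_p p (int n * z))"
    by (rule sum.reindex_bij_witness[of _ int nat]) auto
  also have "\<dots> = (\<Sum>n<p. e_p p z ^ n)"
    by (simp add: e_p_power)
  also have "\<dots> = (if int p dvd z then of_nat p else 0)"
  proof (cases "int p dvd z")
    case True
    then show ?thesis using assms by (simp add: e_p_eq_1_iff[symmetric])
  next
    case False
    then have "e_p p z \<noteq> 1" using assms by (simp add: e_p_eq_1_iff)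
    moreover have "e_p p z ^ p = 1"
      using assms by (simp add: e_p_power e_p_eq_1_iff)
    ultimately show ?thesis using False by (simp add: sum_gp_strict)
  qed
  finally show ?thesis .
qed

text \<open>Expanding the square and summing over \<open>t\<close> first leaves, by orthogonality,
  only the pairs with congruent frequencies. The index type is left open and frequencies may
  coincide, because the shift argument takes \<open>r\<close>-tuples as indices.\<close>

lemma sum_norm_e_p_square:
  assumes "p > 0" "finite I"
  shows "complex_of_real (\<Sum>t\<in>{0..<int p}. (norm (\<Sum>i\<in>I. c i * e_p p (t * \<sigma> i)))\<^sup>2)
           = of_nat p * (\<Sum>(i, j) | i \<in> I \<and> j \<in> I \<and> [\<sigma> i = \<sigma> j] (mod int p). c i * cnj (c j))"
proof -
  have "complex_of_real (\<Sum>t\<in>{0..<int p}. (norm (\<Sum>i\<in>I. c i * e_p p (t * \<sigma> i)))\<^sup>2)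
        = (\<Sum>t\<in>{0..<int p}. \<Sum>i\<in>I. \<Sum>j\<in>I. c i * cnj (c j) * e_p p (t * (\<sigma> i - \<sigma> j)))"
    unfolding of_real_sum
  proof (rule sum.cong[OF refl])
    fix t
    have "e_p p (t * (\<sigma> i - \<sigma> j)) = e_p p (t * \<sigma> i) * cnj (e_p p (t * \<sigma> j))" for i j
      by (simp add: e_p_minus[symmetric] e_p_add[symmetric] right_diff_distrib)
    then show "complex_of_real ((norm (\<Sum>i\<in>I. c i * e_p p (t * \<sigma> i)))\<^sup>2)
        = (\<Sum>i\<in>I. \<Sum>j\<in>I. c i * cnj (c j) * e_p p (t * (\<sigma> i - \<sigma> j)))"
      unfolding complex_norm_square by (simp add: sum_product mult_ac)
  qed
  also have "\<dots> = (\<Sum>i\<in>I. \<Sum>j\<in>I. \<Sum>t\<in>{0..<int p}. c i * cnj (c j) * e_p p (t * (\<sigma> i - \<sigma> j)))"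
    by (subst sum.swap, rule sum.cong[OF refl], subst sum.swap, rule refl)
  also have "\<dots> = (\<Sum>i\<in>I. \<Sum>j\<in>I. of_nat p * (if [\<sigma> i = \<sigma> j] (mod int p) then c i * cnj (c j) else 0))"
    by (intro sum.cong refl)
       (simp add: sum_distrib_left[symmetric] sum_e_p[OF assms(1)] cong_iff_dvd_diff)
  also have "\<dots> = of_nat p * (\<Sum>(i, j)\<in>I \<times> I. if [\<sigma> i = \<sigma> j] (mod int p) then c i * cnj (c j) else 0)"
    by (simp add: sum.cartesian_product sum_distrib_left case_prod_unfold)
  also have "(\<Sum>(i, j)\<in>I \<times> I. if [\<sigma> i = \<sigma> j] (mod int p) then c i * cnj (c j) else 0)
     = (\<Sum>(i, j) | i \<in> I \<and> j \<in> I \<and> [\<sigma> i = \<sigma> j] (mod int p). c i * cnj (c j))"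
    by (rule sum.mono_neutral_cong_right) (use assms(2) in \<open>auto split: if_splits\<close>)
  finally show ?thesis .
qed

text \<open>For coefficients of modulus at most one, bounding a second moment reduces to counting
  coincidences among the frequencies; the coefficients themselves disappear.\<close>

lemma sum_norm_e_p_square_le:
  assumes "p > 0" "finite I" "\<And>i. i \<in> I \<Longrightarrow> norm (c i) \<le> 1"
  shows "(\<Sum>t\<in>{0..<int p}. (norm (\<Sum>i\<in>I. c i * e_p p (t * \<sigma> i)))\<^sup>2)
           \<le> real p * real (card {(i, j). i \<in> I \<and> j \<in> I \<and> [\<sigma> i = \<sigma> j] (mod int p)})"
    (is "?S \<le> _ * real (card ?Q)")
proof -
  have "?S = norm (complex_of_real ?S)"
    unfolding norm_of_real by (simp add: sum_nonneg)
  also have "\<dots> = real p * norm (\<Sum>(i, j)\<in>?Q. c i * cnj (c j))"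
    unfolding sum_norm_e_p_square[OF assms(1,2)] by (simp add: norm_mult)
  also have "norm (\<Sum>(i, j)\<in>?Q. c i * cnj (c j)) \<le> (\<Sum>q\<in>?Q. 1)"
    by (rule sum_norm_le) (auto simp: norm_mult intro!: mult_le_one assms(3))
  finally show ?thesis by (simp add: mult_left_mono)
qed

lemma sum_norm_e_p_square_inj:
  assumes "p > 0" "finite I" "\<And>i j. \<lbrakk>i \<in> I; j \<in> I; [\<sigma> i = \<sigma> j] (mod int p)\<rbrakk> \<Longrightarrow> i = j"
  shows "(\<Sum>t\<in>{0..<int p}. (norm (\<Sum>i\<in>I. c i * e_p p (t * \<sigma> i)))\<^sup>2)
           = real p * (\<Sum>i\<in>I. (norm (c i))\<^sup>2)"
proof -
  have "{(i, j). i \<in> I \<and> j \<in> I \<and> [\<sigma> i = \<sigma> j] (mod int p)} = (\<lambda>i. (i, i)) ` I"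
    using assms(3) by auto
  then have "complex_of_real (\<Sum>t\<in>{0..<int p}. (norm (\<Sum>i\<in>I. c i * e_p p (t * \<sigma> i)))\<^sup>2)
     = complex_of_real (real p * (\<Sum>i\<in>I. (norm (c i))\<^sup>2))"
    unfolding sum_norm_e_p_square[OF assms(1,2)]
    by (simp add: sum.reindex inj_on_def complex_norm_square[symmetric])
  then show ?thesis by (rule of_real_eq_iff[THEN iffD1])
qed

text \<open>
  The power \<open>x\<^bsup>p - 2\<^esup>\<close> inverts \<open>x\<close> modulo \<open>p\<close> by Fermat's little theorem. Unlike \<^const>\<open>modular_inverse\<close>
  it is a polynomial, so it is multiplicative and respects congruences without any side condition.
\<close>

definition recip :: "nat \<Rightarrow> int \<Rightarrow> int" where
  "recip p x = x ^ (p - 2)"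

lemma recip_cong: "[x = y] (mod int p) \<Longrightarrow> [recip p x = recip p y] (mod int p)"
  unfolding recip_def by (rule cong_pow)

lemma recip_mult: "recip p (x * y) = recip p x * recip p y"
  by (simp add: recip_def power_mult_distrib)

text \<open>The exponent \<open>p - 2\<close> is odd, so this is an identity of integers and not
  only a congruence.\<close>

lemma recip_minus:
  assumes "prime p" "p > 2"
  shows "recip p (- x) = - recip p x"
  using prime_odd_nat[OF assms] assms(2) by (simp add: recip_def)

lemma cong_mult_recip:
  assumes "prime p" "p > 2" "\<not> int p dvd x"
  shows "[x * recip p x = 1] (mod int p)"
proof -
  have "coprime x (int p)"
    using assms by (metis coprime_commute prime_imp_coprime prime_nat_int_transfer)
  moreover have "residues (int p)"
    using assms by (simp add: residues_def)
  ultimately have "[x ^ totient (nat (int p)) = 1] (mod int p)"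
    by (rule residues.euler_theorem[rotated])
  moreover have "totient (nat (int p)) = Suc (p - 2)"
    using assms by (simp add: totient_prime)
  ultimately show ?thesis by (simp add: recip_def)
qed

lemma not_dvd_recip:
  assumes "prime p" "p > 2" "\<not> int p dvd x"
  shows "\<not> int p dvd recip p x"
proof
  assume "int p dvd recip p x"
  then have "int p dvd x * recip p x" by simp
  then have "int p dvd 1"
    using cong_dvd_iff[OF cong_mult_recip[OF assms]] by (simp add: cong_dvd_iff)
  then show False using assms by simp
qed

lemma recip_inj:
  assumes "prime p" "p > 2" "\<not> int p dvd x" "\<not> int p dvd y"
    and "[recip p x = recip p y] (mod int p)"
  shows "[x = y] (mod int p)"
proof -
  have "[x * (y * recip p y) = x * 1] (mod int p)"
    by (intro cong_mult cong_refl cong_mult_recip assms)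
  moreover have "[y * (x * recip p x) = y * 1] (mod int p)"
    by (intro cong_mult cong_refl cong_mult_recip assms)
  moreover have "[x * y * recip p x = x * y * recip p y] (mod int p)"
    by (intro cong_mult cong_refl assms)
  ultimately show ?thesis
    by (simp add: mult_ac) (metis cong_sym cong_trans)
qed

lemma modular_inverse_cong_recip:
  assumes "prime p" "p > 2" "\<not> int p dvd x"
  shows "[modular_inverse (int p) x = recip p x] (mod int p)"
proof -
  have co: "coprime x (int p)"
    using assms by (metis coprime_commute prime_imp_coprime prime_nat_int_transfer)
  have "[x * modular_inverse (int p) x = x * recip p x] (mod int p)"
    using cong_modular_inverse1[OF co] cong_mult_recip[OF assms] by (metis cong_sym cong_trans)
  then show ?thesis using co by (simp add: cong_mult_lcancel)
qed

section \<open>Sums of reciprocals modulo a prime\<close>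

text \<open>Lagrange's bound for the number of roots over a field, turned around. A root
  \<open>a\<close> is split off by synthetic division; since \<open>p\<close> is prime, every other
  root of \<open>f\<close> is a root of the quotient, to which the induction applies. The conclusion
  concerns values rather than coefficients, because later it is contradicted at a single
  point.\<close>

lemma int_poly_roots_mod_prime:
  fixes f :: "int poly"
  assumes "prime p" "degree f \<le> n" "card {x \<in> {0..<int p}. int p dvd poly f x} > n"
  shows "int p dvd poly f x"
  using assms(2,3)
proof (induction n arbitrary: f x)
  case 0
  then obtain c where f: "f = [:c:]"
    by (metis degree_eq_zeroE le_zero_eq)
  have "{x \<in> {0..<int p}. int p dvd poly f x} \<noteq> {}"
    using 0(2) by (metis card.empty less_irrefl)
  then show ?case by (auto simp: f)
next
  case (Suc n)
  let ?Z = "\<lambda>g. {x \<in> {0..<int p}. int p dvd poly g x}"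
  have "?Z f \<noteq> {}"
    using Suc.prems(2) by (metis card.empty not_less_zero)
  then obtain a where a: "a \<in> {0..<int p}" "int p dvd poly f a" by auto
  define q where "q = synthetic_div f a"
  have pf: "poly f y = (y - a) * poly q y + poly f a" for y
    using arg_cong[OF synthetic_div_correct'[of a f], of "\<lambda>h. poly h y"]
    by (simp add: q_def algebra_simps)
  have "?Z f \<subseteq> insert a (?Z q)"
  proof
    fix y assume y: "y \<in> ?Z f"
    then have "int p dvd (y - a) * poly q y"
      using a(2) pf[of y] by (simp add: dvd_add_left_iff)
    then have "int p dvd y - a \<or> int p dvd poly q y"
      using assms(1) by (simp add: prime_dvd_mult_iff)
    moreover have "y = a" if "int p dvd y - a"
      using that y a(1) by (auto simp: cong_iff_dvd_diff[symmetric] cong_def)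
    ultimately show "y \<in> insert a (?Z q)" using y by auto
  qed
  moreover have fin: "finite (?Z q)"
    by (rule finite_subset[of _ "{0..<int p}"]) auto
  ultimately have "card (?Z f) \<le> card (insert a (?Z q))"
    by (intro card_mono) auto
  also have "\<dots> \<le> Suc (card (?Z q))"
    unfolding card_insert_if[OF fin] by simp
  finally have "card (?Z f) \<le> Suc (card (?Z q))" .
  then have "card (?Z q) > n" using Suc.prems(2) by simp
  moreover have "degree q \<le> n" using Suc.prems(1) by (simp add: q_def degree_synthetic_div)
  ultimately have "int p dvd poly q x" by (intro Suc.IH)
  then show ?case using pf[of x] a(2) by simp
qed

section \<open>Counting congruences between two sums of \<open>r\<close> shifted reciprocals\<close>

definition tuples :: "nat \<Rightarrow> nat \<Rightarrow> (nat \<Rightarrow> int) set" where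
  "tuples r B = {..<r} \<rightarrow>\<^sub>E {0..<int B}"

text \<open>Parseval applied to a moment of order \<open>2r\<close> leads to these pairs. The
  divisibility conditions keep \<open>s\<close> away from the poles, where the power
  \<open>recip\<close> is no inverse.\<close>

definition recip_pairs :: "nat \<Rightarrow> nat \<Rightarrow> nat \<Rightarrow> int \<Rightarrow> ((nat \<Rightarrow> int) \<times> (nat \<Rightarrow> int)) set" where
  "recip_pairs p r B s = {(f, g) \<in> tuples r B \<times> tuples r B.
      (\<forall>i<r. \<not> int p dvd s + f i \<and> \<not> int p dvd s + g i) \<and>
      [(\<Sum>i<r. recip p (s + f i)) = (\<Sum>i<r. recip p (s + g i))] (mod int p)}"

lemma finite_tuples [simp]: "finite (tuples r B)"
  by (simp add: tuples_def finite_PiE)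

lemma card_tuples: "card (tuples r B) = B ^ r"
  by (simp add: tuples_def card_PiE)

lemma finite_recip_pairs [simp]: "finite (recip_pairs p r B s)"
  by (rule finite_subset[of _ "tuples r B \<times> tuples r B"]) (auto simp: recip_pairs_def)

text \<open>
  Clearing denominators gives the polynomial \<open>P\<close>; if the value \<open>g j\<close> is not attained by \<open>f\<close>, only terms
  coming from \<open>g\<close> survive in \<open>P (- g j)\<close>, and there are between \<open>1\<close> and \<open>r < p\<close> of them.
\<close>

lemma card_recip_pairs_roots:
  assumes "prime p" "p > 2" "r < p" "B \<le> p" "f \<in> tuples r B" "g \<in> tuples r B"
    and "\<not> g ` {..<r} \<subseteq> f ` {..<r}"
  shows "card {s \<in> {0..<int p}. (f, g) \<in> recip_pairs p r B s} \<le> 2 * r"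
proof -
  define D where "D = f ` {..<r} \<union> g ` {..<r}"
  \<comment> \<open>Indexing by the set \<open>D\<close> keeps the factors of the common denominator
    distinct, whatever the multiplicities in \<open>f\<close> and \<open>g\<close>. For
    \<open>x\<close> in \<open>D\<close>, \<open>R x\<close> is this denominator without the factor
    of \<open>x\<close>.\<close>
  define R where "R x = (\<Prod>c\<in>D - {x}. [:c, 1:])" for x :: int
  define P where "P = (\<Sum>i<r. R (f i)) - (\<Sum>i<r. R (g i))"
  obtain j where j: "j < r" "g j \<notin> f ` {..<r}" using assms(7) by auto
  have finD: "finite D" by (simp add: D_def)
  have polyR: "poly (R x) s = (\<Prod>c\<in>D - {x}. s + c)" for x s
    by (simp add: R_def poly_prod add.commute)
  have cardD: "card D \<le> 2 * r"
  proof -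
    have "card D \<le> card (f ` {..<r}) + card (g ` {..<r})"
      unfolding D_def by (rule card_Un_le)
    also have "\<dots> \<le> r + r"
      by (intro add_mono) (metis card_image_le card_lessThan finite_lessThan)+
    finally show ?thesis by simp
  qed
  have degR: "degree (R x) \<le> 2 * r" for x
  proof -
    have "degree (R x) \<le> (\<Sum>c\<in>D - {x}. (degree \<circ> (\<lambda>c. [:c, 1:])) c)"
      unfolding R_def by (rule degree_prod_sum_le) (use finD in auto)
    also have "\<dots> \<le> card D" using finD by (simp add: card_mono)
    finally show ?thesis using cardD by simp
  qed
  have degP: "degree P \<le> 2 * r"
    unfolding P_def by (intro degree_diff_le degree_sum_le degR) auto
  have Drange: "c \<in> {0..<int B}" if "c \<in> D" for c
    using that PiE_mem[OF assms(5)[unfolded tuples_def]] PiE_mem[OF assms(6)[unfolded tuples_def]]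
    unfolding D_def by blast
  have "poly P (- g j) = - (\<Sum>i<r. if g i = g j then (\<Prod>c\<in>D - {g j}. c - g j) else 0)"
  proof -
    have z: "poly (R x) (- g j) = (if x = g j then (\<Prod>c\<in>D - {g j}. c - g j) else 0)" for x
    proof (cases "x = g j")
      case False
      have "g j \<in> D - {x}" using j False by (auto simp: D_def)
      then show ?thesis using False finD unfolding polyR by (auto intro!: prod_zero)
    qed (simp add: polyR)
    have "(\<Sum>i<r. poly (R (f i)) (- g j)) = 0"
      unfolding z using j by (intro sum.neutral) (force simp: image_iff)
    then show ?thesis by (simp add: P_def poly_diff poly_sum z)
  qed
  also have "\<dots> = - (int (card {i. i < r \<and> g i = g j}) * (\<Prod>c\<in>D - {g j}. c - g j))"
    by (simp add: sum.If_cases Int_def)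
  finally have Pj: "poly P (- g j) = \<dots>" .
  have "\<not> int p dvd poly P (- g j)"
  proof
    assume "int p dvd poly P (- g j)"
    then have "int p dvd int (card {i. i < r \<and> g i = g j}) \<or> int p dvd (\<Prod>c\<in>D - {g j}. c - g j)"
      using assms(1) unfolding Pj by (simp add: prime_dvd_mult_iff)
    then show False
    proof
      assume "int p dvd int (card {i. i < r \<and> g i = g j})"
      then have dv: "p dvd card {i. i < r \<and> g i = g j}" by simp
      have sub: "{i. i < r \<and> g i = g j} \<subseteq> {..<r}" and j': "j \<in> {i. i < r \<and> g i = g j}"
        using j(1) by auto
      then have "card {i. i < r \<and> g i = g j} > 0"
        unfolding card_gt_0_iff by (metis empty_iff finite_lessThan finite_subset)
      then have "p \<le> card {i. i < r \<and> g i = g j}"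
        using dv by (rule dvd_imp_le[rotated])
      also have "\<dots> \<le> r"
        using card_mono[OF _ sub] by simp
      finally show False using assms(3) by simp
    next
      assume "int p dvd (\<Prod>c\<in>D - {g j}. c - g j)"
      \<comment> \<open>Elements of \<open>D\<close> lie in \<open>{0..<int B}\<close> with
        \<open>B \<le> p\<close>, so distinct ones stay distinct modulo \<open>p\<close>.\<close>
      then obtain c where c: "c \<in> D - {g j}" "int p dvd c - g j"
        using finD assms(1) by (auto simp: prime_dvd_prod_iff)
      moreover have "g j \<in> D" using j by (auto simp: D_def)
      ultimately show False
        using Drange[of c] Drange[of "g j"] assms(4)
        by (auto simp: cong_iff_dvd_diff[symmetric] cong_def)
    qed
  qed
  then have "card {x \<in> {0..<int p}. int p dvd poly P x} \<le> 2 * r"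
    using int_poly_roots_mod_prime[OF assms(1) degP, of "- g j"] by linarith
  moreover have "{s \<in> {0..<int p}. (f, g) \<in> recip_pairs p r B s}
                   \<subseteq> {x \<in> {0..<int p}. int p dvd poly P x}"
  proof (rule subsetI)
    fix s assume s: "s \<in> {s \<in> {0..<int p}. (f, g) \<in> recip_pairs p r B s}"
    then have nz: "\<And>c. c \<in> D \<Longrightarrow> \<not> int p dvd s + c"
      and eq: "[(\<Sum>i<r. recip p (s + f i)) = (\<Sum>i<r. recip p (s + g i))] (mod int p)"
      by (auto simp: recip_pairs_def D_def)
    \<comment> \<open>Away from the poles \<open>R x\<close> is the common denominator times the
      reciprocal of \<open>s + x\<close>. Hence \<open>P\<close> at \<open>s\<close> is congruent to
      a multiple of the difference of the two sums of reciprocals, which vanishes modulo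
      \<open>p\<close> at a solution.\<close>
    have R: "[poly (R x) s = (\<Prod>c\<in>D. s + c) * recip p (s + x)] (mod int p)" if "x \<in> D" for x
    proof -
      have "[poly (R x) s * ((s + x) * recip p (s + x)) = poly (R x) s * 1] (mod int p)"
        by (intro cong_mult cong_refl cong_mult_recip assms nz that)
      moreover have "(\<Prod>c\<in>D. s + c) = (s + x) * poly (R x) s"
        unfolding polyR using finD that by (simp add: prod.remove)
      ultimately show ?thesis by (simp add: mult_ac cong_sym)
    qed
    have "[poly P s = (\<Sum>i<r. (\<Prod>c\<in>D. s + c) * recip p (s + f i))
                     - (\<Sum>i<r. (\<Prod>c\<in>D. s + c) * recip p (s + g i))] (mod int p)"
      unfolding P_def poly_diff poly_sum by (intro cong_diff cong_sum R) (auto simp: D_def)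
    also have "(\<Sum>i<r. (\<Prod>c\<in>D. s + c) * recip p (s + f i))
                     - (\<Sum>i<r. (\<Prod>c\<in>D. s + c) * recip p (s + g i))
       = (\<Prod>c\<in>D. s + c) * ((\<Sum>i<r. recip p (s + f i)) - (\<Sum>i<r. recip p (s + g i)))"
      by (simp add: sum_distrib_left right_diff_distrib)
    finally have "int p dvd poly P s \<longleftrightarrow> int p dvd (\<Prod>c\<in>D. s + c) * ((\<Sum>i<r. recip p (s + f i)) - (\<Sum>i<r. recip p (s + g i)))"
      by (rule cong_dvd_iff)
    moreover have "int p dvd (\<Sum>i<r. recip p (s + f i)) - (\<Sum>i<r. recip p (s + g i))"
      using eq by (simp only: cong_iff_dvd_diff)
    ultimately have "int p dvd poly P s" by (simp only: dvd_mult)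
    then show "s \<in> {x \<in> {0..<int p}. int p dvd poly P x}" using s by simp
  qed
  moreover have "finite {x \<in> {0..<int p}. int p dvd poly P x}"
    by (rule finite_subset[of _ "{0..<int p}"]) auto
  ultimately show ?thesis
    by (meson card_mono le_trans)
qed

text \<open>Double counting: for each \<open>(f, g)\<close> the admissible \<open>s\<close> are
  counted. If every value of \<open>g\<close> is a value of \<open>f\<close>, all \<open>p\<close>
  residues are allowed for, but given \<open>f\<close> there are at most \<open>r ^ r\<close> such
  \<open>g\<close>, each entry having at most \<open>r\<close> choices. All other pairs admit at
  most \<open>2 * r\<close> residues by the root count.\<close>

lemma sum_card_recip_pairs:
  assumes "prime p" "p > 2" "r < p" "B \<le> p"
  shows "(\<Sum>s\<in>{0..<int p}. card (recip_pairs p r B s)) \<le> p * B ^ r * r ^ r + 2 * r * B ^ (2 * r)"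
proof -
  let ?F = "tuples r B"
  have "(\<Sum>s\<in>{0..<int p}. card (recip_pairs p r B s))
      = (\<Sum>s\<in>{0..<int p}. card {h \<in> ?F \<times> ?F. h \<in> recip_pairs p r B s})"
    by (intro sum.cong refl arg_cong[where f = card]) (auto simp: recip_pairs_def)
  also have "\<dots> = (\<Sum>h\<in>?F \<times> ?F. card {s \<in> {0..<int p}. h \<in> recip_pairs p r B s})"
    by (rule sum_multicount_gen) auto
  also have "\<dots> = (\<Sum>f\<in>?F. \<Sum>g\<in>?F. card {s \<in> {0..<int p}. (f, g) \<in> recip_pairs p r B s})"
    by (simp add: sum.cartesian_product case_prod_unfold)
  also have "\<dots> \<le> (\<Sum>f\<in>?F. \<Sum>g\<in>?F. (if g ` {..<r} \<subseteq> f ` {..<r} then p else 0) + 2 * r)"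
  proof (intro sum_mono)
    fix f g assume fg: "f \<in> ?F" "g \<in> ?F"
    have "card {s \<in> {0..<int p}. (f, g) \<in> recip_pairs p r B s} \<le> card {0..<int p}"
      by (rule card_mono) auto
    then show "card {s \<in> {0..<int p}. (f, g) \<in> recip_pairs p r B s}
             \<le> (if g ` {..<r} \<subseteq> f ` {..<r} then p else 0) + 2 * r"
      using card_recip_pairs_roots[OF assms fg] by auto
  qed
  also have "\<dots> = (\<Sum>f\<in>?F. card {g \<in> ?F. g ` {..<r} \<subseteq> f ` {..<r}} * p) + 2 * r * B ^ (2 * r)"
    by (simp add: sum.distrib card_tuples power_even_eq power2_eq_square sum.If_cases Int_def)
  also have "(\<Sum>f\<in>?F. card {g \<in> ?F. g ` {..<r} \<subseteq> f ` {..<r}} * p) \<le> (\<Sum>f\<in>?F. r ^ r * p)"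
  proof (intro sum_mono mult_right_mono)
    fix f
    have "card {g \<in> ?F. g ` {..<r} \<subseteq> f ` {..<r}} \<le> card ({..<r} \<rightarrow>\<^sub>E f ` {..<r})"
      unfolding tuples_def
      by (rule card_mono) (auto intro!: finite_PiE PiE_I dest: PiE_arb)
    also have "\<dots> = card (f ` {..<r}) ^ r" by (simp add: card_PiE)
    also have "\<dots> \<le> r ^ r"
      by (intro power_mono) (use card_image_le[of "{..<r}" f] in auto)
    finally show "card {g \<in> ?F. g ` {..<r} \<subseteq> f ` {..<r}} \<le> r ^ r" .
  qed simp
  finally show ?thesis by (simp add: card_tuples mult_ac)
qed

section \<open>Fractions modulo a prime\<close>

lemma card_multiples:
  fixes k l h :: int
  assumes "k > 0" "l \<le> h"
  shows "int (card {v \<in> {l<..h}. k dvd v}) = h div k - l div k"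
proof -
  have le_div: "j \<le> m div k \<longleftrightarrow> k * j \<le> m" for j m
    using pos_imp_zdiv_nonneg_iff[OF assms(1), of "m + k * (- j)"] assms(1)
      div_mult_self2[of k m "- j"] by linarith
  have div_less: "m div k < j \<longleftrightarrow> m < k * j" for j m
    using le_div[of j m] by linarith
  have "{v \<in> {l<..h}. k dvd v} = (\<lambda>j. k * j) ` {l div k<..h div k}"
    by (auto simp: le_div div_less elim!: dvdE)
  moreover have "inj_on (\<lambda>j. k * j) {l div k<..h div k}"
    using assms(1) by (auto simp: inj_on_def)
  ultimately have "card {v \<in> {l<..h}. k dvd v} = nat (h div k - l div k)"
    by (simp add: card_image)
  then show ?thesis using assms by (simp add: zdiv_mono1)
qed

lemma sum_inverse_int_eq_harm: "(\<Sum>k\<in>{1..int n}. 1 / real_of_int k) = harm n"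
  unfolding harm_def
  by (rule sum.reindex_bij_witness[of _ int nat]) (auto simp: field_simps)

text \<open>The difference of \<open>harm n\<close> and \<open>ln n\<close> decreases from its value
  one at \<open>n = 1\<close>.\<close>

lemma harm_le_ln:
  assumes "n \<ge> 1"
  shows "harm n \<le> 1 + ln (real n)"
proof -
  obtain m where "n = Suc m" using assms by (cases n) auto
  then show ?thesis
    using decseqD[OF decseq_harm_diff_ln, of 0 m] by (simp add: harm_def)
qed

lemma gcd_in_range:
  fixes a v :: int
  assumes "a \<in> {1..n}"
  shows "gcd v a \<in> {1..n}"
proof -
  have "gcd v a > 0" using assms by simp
  moreover have "gcd v a \<le> a" using assms by (intro zdvd_imp_le) auto
  ultimately show ?thesis using assms unfolding atLeastAtMost_iff by linarith
qed

text \<open>This is the total mass of the weights in Hoelder's inequality; it exceeds the number of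
  pairs only by a logarithm. The gcd is bounded by the sum of all common divisors \<open>k\<close>,
  and for each \<open>k\<close> there are at most \<open>3 K / k\<close> multiples \<open>v\<close>
  and \<open>A / k\<close> multiples \<open>a\<close>.\<close>

lemma sum_gcd_le:
  assumes "A \<le> K"
  shows "(\<Sum>v\<in>{1 - int K..int K}. \<Sum>a\<in>{1..int A}. real_of_int (gcd v a)) \<le> 3 * real K * real A * harm A"
proof -
  let ?V = "{1 - int K..int K}" and ?A = "{1..int A}"
  have "(\<Sum>v\<in>?V. \<Sum>a\<in>?A. real_of_int (gcd v a))
      \<le> (\<Sum>v\<in>?V. \<Sum>a\<in>?A. \<Sum>k\<in>?A. of_int k * (of_bool (k dvd v) * of_bool (k dvd a)))"
  proof (intro sum_mono)
    fix v a :: int assume a: "a \<in> ?A"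
    have g: "gcd v a \<in> ?A"
      using a by (rule gcd_in_range)
    have "real_of_int (gcd v a) = of_int (gcd v a) * (of_bool (gcd v a dvd v) * of_bool (gcd v a dvd a))"
      by simp
    also have "\<dots> \<le> (\<Sum>k\<in>?A. of_int k * (of_bool (k dvd v) * of_bool (k dvd a)))"
      by (rule member_le_sum[OF g]) auto
    finally show "real_of_int (gcd v a) \<le> \<dots>" .
  qed
  also have "\<dots> = (\<Sum>k\<in>?A. \<Sum>v\<in>?V. \<Sum>a\<in>?A. of_int k * (of_bool (k dvd v) * of_bool (k dvd a)))"
    by (subst sum.swap[of _ ?A ?A], subst sum.swap[of _ ?A ?V], rule refl)
  also have "\<dots> = (\<Sum>k\<in>?A. of_int k * ((\<Sum>v\<in>?V. of_bool (k dvd v)) * (\<Sum>a\<in>?A. of_bool (k dvd a))))"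
    by (simp only: sum_product, simp only: sum_distrib_left)
  also have "\<dots> \<le> (\<Sum>k\<in>?A. 3 * real K * real A * (1 / of_int k))"
  proof (intro sum_mono)
    fix k :: int assume k: "k \<in> ?A"
    have V: "?V = {- int K<..int K}" and A: "?A = {0<..int A}" by auto
    have "(\<Sum>a\<in>?A. of_bool (k dvd a)) = real_of_int (int (card {a \<in> {0<..int A}. k dvd a}))"
      by (simp add: A Int_def)
    also have "\<dots> = real_of_int (int A div k)"
      using k by (subst card_multiples) auto
    also have "\<dots> \<le> real A / of_int k"
      using floor_divide_of_int_eq[of "int A" k, where ?'a = real]
      by (metis of_int_floor_le of_int_of_nat_eq)
    finally have 1: "(\<Sum>a\<in>?A. of_bool (k dvd a)) \<le> real A / of_int k" .
    have "(\<Sum>v\<in>?V. of_bool (k dvd v)) = real_of_int (int (card {a \<in> {- int K<..int K}. k dvd a}))"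
      by (simp add: V Int_def)
    also have "\<dots> = real_of_int (int K div k - (- int K) div k)"
      using k by (subst card_multiples) auto
    also have "\<dots> = of_int \<lfloor>real K / of_int k\<rfloor> - of_int \<lfloor>- (real K / of_int k)\<rfloor>"
      using floor_divide_of_int_eq[of "int K" k, where ?'a = real]
        floor_divide_of_int_eq[of "- int K" k, where ?'a = real] by simp
    also have "\<dots> \<le> 2 * (real K / of_int k) + 1"
      by linarith
    \<comment> \<open>The rounding error is absorbed into the main term because
      \<open>k \<le> A \<le> K\<close>.\<close>
    also have "1 \<le> real K / of_int k"
      using k assms by (auto simp: field_simps)
    finally have 2: "(\<Sum>v\<in>?V. of_bool (k dvd v)) \<le> 3 * (real K / of_int k)" by simp
    have "of_int k * ((\<Sum>v\<in>?V. of_bool (k dvd v)) * (\<Sum>a\<in>?A. of_bool (k dvd a)))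
        \<le> of_int k * ((3 * (real K / of_int k)) * (real A / of_int k))"
      using k by (intro mult_left_mono mult_mono 1 2) (auto intro!: sum_nonneg)
    also have "\<dots> = 3 * real K * real A * (1 / of_int k)"
      using k by (simp add: field_simps)
    finally show "of_int k * ((\<Sum>v\<in>?V. of_bool (k dvd v)) * (\<Sum>a\<in>?A. of_bool (k dvd a)))
        \<le> 3 * real K * real A * (1 / of_int k)" .
  qed
  also have "\<dots> = 3 * real K * real A * harm A"
    by (simp only: sum_distrib_left[symmetric] sum_inverse_int_eq_harm)
  finally show ?thesis .
qed

text \<open>Clearing denominators gives a congruence between integers of modulus at most
  \<open>K * A\<close>; as \<open>2 * K * A < p\<close>, it is an equality.\<close>

lemma quotients_eq_imp_cross_eq:
  assumes p: "prime p" "p > 2" and KA: "2 * K * A < p"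
    and v: "v \<in> {1 - int K..int K}" "v' \<in> {1 - int K..int K}"
    and a: "a \<in> {1..int A}" "a' \<in> {1..int A}"
    and eq: "[v * recip p a = v' * recip p a'] (mod int p)"
  shows "v * a' = v' * a"
proof -
  have Ap: "int A < int p"
  proof -
    have "K \<ge> 1" using v by auto
    then have "A \<le> 2 * K * A" by simp
    then show ?thesis using KA by linarith
  qed
  have nd: "\<not> int p dvd a" "\<not> int p dvd a'"
    using a Ap by (auto dest!: zdvd_imp_le)
  have "[v * a' * (a * recip p a) = v * a' * 1] (mod int p)"
    "[v' * a * (a' * recip p a') = v' * a * 1] (mod int p)"
    by (intro cong_mult cong_refl cong_mult_recip p nd)+
  moreover have "[(v * recip p a) * (a * a') = (v' * recip p a') * (a * a')] (mod int p)"
    by (intro cong_mult cong_refl eq)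
  ultimately have "[v * a' = v' * a] (mod int p)"
    by (simp add: mult_ac) (metis cong_sym cong_trans)
  then have d: "int p dvd v * a' - v' * a" by (simp add: cong_iff_dvd_diff)
  have "\<bar>v * a'\<bar> \<le> int K * int A" "\<bar>v' * a\<bar> \<le> int K * int A"
    unfolding abs_mult using v a by (intro mult_mono; auto)+
  then have "\<bar>v * a' - v' * a\<bar> < int p"
    using KA by (simp flip: of_nat_mult)
  then show ?thesis using d by (metis dvd_imp_le_int abs_of_nat eq_iff_diff_eq_0 not_le)
qed

text \<open>Pairs with the same quotient \<open>s\<close> are proportional, hence multiples of one
  primitive pair, and the gcd tells them apart. The weights \<open>1 / gcd v a\<close> over one
  fibre are therefore distinct reciprocals of integers in \<open>{1..int A}\<close> and sum to at
  most \<open>harm A\<close>.\<close>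

lemma sum_over_quotients_le:
  fixes q :: "int \<Rightarrow> real"
  assumes p: "prime p" "p > 2" and KA: "2 * K * A < p" and q: "\<And>s. q s \<ge> 0"
  shows "(\<Sum>(v, a)\<in>{1 - int K..int K} \<times> {1..int A}. q ((v * recip p a) mod int p) / of_int (gcd v a))
           \<le> harm A * (\<Sum>s\<in>{0..<int p}. q s)"
proof -
  let ?I = "{1 - int K..int K} \<times> {1..int A}"
  let ?s = "\<lambda>(v, a). (v * recip p a) mod int p"
  have "(\<Sum>(v, a)\<in>?I. q ((v * recip p a) mod int p) / of_int (gcd v a))
      = (\<Sum>i\<in>?I. q (?s i) / of_int (gcd (fst i) (snd i)))"
    by (simp add: case_prod_unfold)
  also have "\<dots> = (\<Sum>s\<in>{0..<int p}. \<Sum>i\<in>{i \<in> ?I. ?s i = s}. q (?s i) / of_int (gcd (fst i) (snd i)))"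
    by (rule sum.group[symmetric]) (use p in auto)
  also have "\<dots> = (\<Sum>s\<in>{0..<int p}. q s * (\<Sum>i\<in>{i \<in> ?I. ?s i = s}. 1 / of_int (gcd (fst i) (snd i))))"
    unfolding sum_distrib_left by (intro sum.cong refl) auto
  also have "\<dots> \<le> (\<Sum>s\<in>{0..<int p}. q s * harm A)"
  proof (intro sum_mono mult_left_mono q)
    fix s
    let ?J = "{i \<in> ?I. ?s i = s}" and ?g = "\<lambda>i::int \<times> int. gcd (fst i) (snd i)"
    have inj: "inj_on ?g ?J"
    proof (rule inj_onI, clarsimp)
      fix v a v' a' :: int
      assume *: "1 - int K \<le> v" "v \<le> int K" "1 \<le> a" "a \<le> int A"
        "1 - int K \<le> v'" "v' \<le> int K" "1 \<le> a'" "a' \<le> int A" "gcd v a = gcd v' a'"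
        "v' * recip p a' mod int p = v * recip p a mod int p"
      then have eq: "v * a' = v' * a"
        by (intro quotients_eq_imp_cross_eq[OF p KA]) (auto simp: cong_def)
      \<comment> \<open>Evaluating the gcd of \<open>v * a'\<close> and \<open>a * a'\<close> in two
        ways shows that proportional pairs with equal gcd have equal denominators.\<close>
      have "gcd v a * a' = gcd (v * a') (a * a')"
        using * by (simp add: gcd_mult_right gcd.commute)
      also have "\<dots> = gcd (v' * a) (a' * a)"
        unfolding eq by (simp add: mult.commute)
      also have "\<dots> = gcd v' a' * a"
        using * by (simp add: gcd_mult_right gcd.commute)
      finally have "gcd v a * a' = gcd v a * a" using * by simp
      then have "a' = a" using * by simp
      then show "v = v' \<and> a = a'" using eq * by auto
    qed
    have "(\<Sum>i\<in>?J. 1 / real_of_int (?g i)) = (\<Sum>k\<in>?g ` ?J. 1 / real_of_int k)"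
      by (simp add: sum.reindex[OF inj])
    also have "\<dots> \<le> (\<Sum>k\<in>{1..int A}. 1 / real_of_int k)"
    proof (rule sum_mono2)
      show "?g ` ?J \<subseteq> {1..int A}"
        using gcd_in_range by fastforce
    qed auto
    finally show "(\<Sum>i\<in>?J. 1 / real_of_int (?g i)) \<le> harm A"
      by (simp add: sum_inverse_int_eq_harm)
  qed
  also have "\<dots> = harm A * (\<Sum>s\<in>{0..<int p}. q s)"
    by (simp add: sum_distrib_left mult.commute)
  finally show ?thesis .
qed

section \<open>The shift argument\<close>

text \<open>Hoelder's inequality, obtained as Jensen's inequality for \<open>y ^ n\<close> at the
  points \<open>x i / w i\<close> with weights \<open>w i / W\<close>.\<close>

lemma weighted_power_mean:
  fixes x w :: "'a \<Rightarrow> real"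
  assumes "finite I" "\<And>i. i \<in> I \<Longrightarrow> w i > 0" "\<And>i. i \<in> I \<Longrightarrow> x i \<ge> 0" "n \<ge> 1"
  shows "(\<Sum>i\<in>I. x i) ^ n \<le> (\<Sum>i\<in>I. w i) ^ (n - 1) * (\<Sum>i\<in>I. x i ^ n / w i ^ (n - 1))"
proof (cases "I = {}")
  case True
  then show ?thesis using assms(4) by (simp add: power_0_left)
next
  case False
  obtain m where n: "n = Suc m" using assms(4) by (cases n) auto
  define W where "W = (\<Sum>i\<in>I. w i)"
  have W: "W > 0" unfolding W_def using assms False by (intro sum_pos) auto
  have "(\<Sum>i\<in>I. (w i / W) *\<^sub>R (x i / w i)) ^ n \<le> (\<Sum>i\<in>I. (w i / W) * (x i / w i) ^ n)"
  proof (rule convex_on_sum[where f = "\<lambda>y. y ^ n" and C = "{0..}"])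
    show "convex_on {0..} (\<lambda>y::real. y ^ n)"
      using convex_on_subset[OF convex_power_even[of n]] convex_power_odd[of n]
      by (cases "even n") auto
    show "(\<Sum>i\<in>I. w i / W) = 1"
      using W by (simp add: sum_divide_distrib[symmetric] W_def)
    show "w i / W \<ge> 0" if "i \<in> I" for i
      using assms(2)[OF that] W by simp
    show "x i / w i \<in> {0..}" if "i \<in> I" for i
      using assms(2,3)[OF that] by simp
  qed (fact assms(1) False)+
  also have "(\<Sum>i\<in>I. (w i / W) *\<^sub>R (x i / w i)) = (\<Sum>i\<in>I. x i) / W"
    unfolding sum_divide_distrib
    by (intro sum.cong refl) (use assms(2) in \<open>auto simp: less_imp_neq[THEN not_sym]\<close>)
  also have "(\<Sum>i\<in>I. (w i / W) * (x i / w i) ^ n) = (\<Sum>i\<in>I. x i ^ n / w i ^ m) / W"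
    unfolding sum_divide_distrib
    by (intro sum.cong refl) (use assms(2) in \<open>auto simp: n power_divide less_imp_neq[THEN not_sym]\<close>)
  finally have "((\<Sum>i\<in>I. x i) / W) ^ n * W ^ n \<le> (\<Sum>i\<in>I. x i ^ n / w i ^ m) / W * W ^ n"
    using W by (intro mult_right_mono) auto
  then show ?thesis
    using W by (simp add: power_divide n W_def[symmetric] mult_ac)
qed

lemma sum_power_eq_sum_PiE:
  fixes h :: "'a \<Rightarrow> 'b::comm_semiring_1"
  assumes "finite S"
  shows "(\<Sum>b\<in>S. h b) ^ r = (\<Sum>f\<in>{..<r} \<rightarrow>\<^sub>E S. \<Prod>i<r. h (f i))"
  using prod_sum_PiE[of "{..<r}" "\<lambda>_. S" "\<lambda>_. h"] assms by simp

text \<open>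
  The coefficients \<open>c (v + a b)\<close> may depend on \<open>v\<close>, \<open>a\<close> and \<open>b\<close> in any way, because the sum over \<open>t\<close> is
  carried out first; this absorbs both the phase of \<open>G\<close> and the cut-off \<open>v + a b \<in> {1..K}\<close>.
\<close>

lemma shifted_moment_le:
  fixes c :: "int \<Rightarrow> complex" and v :: int and B :: nat
  assumes p: "prime p" "p > 2" and "K < p" "\<not> int p dvd a" and c: "\<And>u. norm (c u) \<le> 1"
  defines "S \<equiv> {b \<in> {0..<int B}. v + a * b \<in> {1..int K}}"
  shows "(\<Sum>t\<in>{0..<int p}. norm (\<Sum>b\<in>S. c (v + a * b) * e_p p (t * recip p (v + a * b))) ^ (2 * r))
           \<le> real p * real (card (recip_pairs p r B ((v * recip p a) mod int p)))"
proof -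
  define I where "I = {..<r} \<rightarrow>\<^sub>E S"
  define d where "d f = (\<Prod>i<r. c (v + a * f i))" for f :: "nat \<Rightarrow> int"
  define \<sigma> where "\<sigma> f = (\<Sum>i<r. recip p (v + a * f i))" for f :: "nat \<Rightarrow> int"
  define s where "s = (v * recip p a) mod int p"
  have finS: "finite S" by (rule finite_subset[of _ "{0..<int B}"]) (auto simp: S_def)
  have finI: "finite I" by (simp add: I_def finite_PiE finS)
  \<comment> \<open>The \<open>r\<close>-th power of the inner sum is an exponential sum over
    \<open>r\<close>-tuples, so the moment of order \<open>2 * r\<close> is a second moment.\<close>
  have pow: "norm (\<Sum>b\<in>S. c (v + a * b) * e_p p (t * recip p (v + a * b))) ^ (2 * r)
           = (norm (\<Sum>f\<in>I. d f * e_p p (t * \<sigma> f)))\<^sup>2" for t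
  proof -
    have eq: "(\<Sum>b\<in>S. c (v + a * b) * e_p p (t * recip p (v + a * b))) ^ r = (\<Sum>f\<in>I. d f * e_p p (t * \<sigma> f))"
      unfolding sum_power_eq_sum_PiE[OF finS] I_def[symmetric]
      by (simp add: d_def \<sigma>_def prod.distrib sum_distrib_left e_p_sum)
    show ?thesis
      unfolding eq[symmetric] power_even_eq norm_power ..
  qed
  have as: "[a * (s + b) = v + a * b] (mod int p)" for b
  proof -
    have "[v * (a * recip p a) + a * b = v * 1 + a * b] (mod int p)"
      by (intro cong_add cong_mult cong_refl cong_mult_recip p assms)
    moreover have "[a * (s + b) = a * (v * recip p a + b)] (mod int p)"
      unfolding s_def by (intro cong_mult cong_add cong_refl) (simp add: cong_def)
    ultimately show ?thesis
      by (simp add: algebra_simps) (metis cong_trans)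
  qed
  \<comment> \<open>The poles are avoided because \<open>v + a * b\<close> is a positive integer
    below \<open>p\<close>.\<close>
  have nd: "\<not> int p dvd s + b" if "b \<in> S" for b
  proof
    assume "int p dvd s + b"
    then have "int p dvd a * (s + b)" by simp
    then have "int p dvd v + a * b" using cong_dvd_iff[OF as[of b]] by simp
    moreover have "v + a * b \<in> {1..int K}" using that by (simp add: S_def)
    ultimately show False using \<open>K < p\<close> by (auto dest!: zdvd_imp_le)
  qed
  have "{(f, g). f \<in> I \<and> g \<in> I \<and> [\<sigma> f = \<sigma> g] (mod int p)} \<subseteq> recip_pairs p r B s"
  proof clarify
    fix f g assume fg: "f \<in> I" "g \<in> I" and eq: "[\<sigma> f = \<sigma> g] (mod int p)"
    \<comment> \<open>The common factor \<open>recip p a\<close> is invertible and cancels, so the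
      resulting count depends on \<open>v\<close> and \<open>a\<close> only through their quotient
      \<open>s\<close>.\<close>
    have sg: "[\<sigma> h = recip p a * (\<Sum>i<r. recip p (s + h i))] (mod int p)" for h
      unfolding \<sigma>_def sum_distrib_left recip_mult[symmetric]
      by (intro cong_sum recip_cong cong_sym[OF as])
    have "coprime (recip p a) (int p)"
      using not_dvd_recip[OF p \<open>\<not> int p dvd a\<close>] p(1)
      by (metis coprime_commute prime_imp_coprime prime_nat_int_transfer)
    then have "[(\<Sum>i<r. recip p (s + f i)) = (\<Sum>i<r. recip p (s + g i))] (mod int p)"
      using cong_trans[OF cong_sym[OF sg[of f]] cong_trans[OF eq sg[of g]]]
      by (simp add: cong_mult_lcancel)
    moreover have "h \<in> tuples r B" "\<And>i. i < r \<Longrightarrow> h i \<in> S" if "h \<in> I" for h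
    proof -
      have "I \<subseteq> tuples r B" unfolding I_def tuples_def by (rule PiE_mono) (auto simp: S_def)
      then show "h \<in> tuples r B" "\<And>i. i < r \<Longrightarrow> h i \<in> S"
        using that by (auto simp: I_def)
    qed
    ultimately show "(f, g) \<in> recip_pairs p r B s"
      using fg nd by (auto simp: recip_pairs_def)
  qed
  then have "card {(f, g). f \<in> I \<and> g \<in> I \<and> [\<sigma> f = \<sigma> g] (mod int p)} \<le> card (recip_pairs p r B s)"
    by (intro card_mono) auto
  moreover have "(\<Sum>t\<in>{0..<int p}. (norm (\<Sum>f\<in>I. d f * e_p p (t * \<sigma> f)))\<^sup>2)
      \<le> real p * real (card {(f, g). f \<in> I \<and> g \<in> I \<and> [\<sigma> f = \<sigma> g] (mod int p)})"
    by (rule sum_norm_e_p_square_le)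
       (use p finI in \<open>auto simp: d_def prod_norm[symmetric] intro!: prod_le_1 c\<close>)
  ultimately show ?thesis
    unfolding pow s_def[symmetric]
    by (meson mult_left_mono of_nat_0_le_iff of_nat_le_iff order_trans)
qed

text \<open>For fixed \<open>a\<close> and \<open>b\<close> the map from \<open>v\<close> to
  \<open>v + a * b\<close> is a translation by at most \<open>K\<close>. The range of
  \<open>v\<close> is long enough to contain \<open>u - a * b\<close> for every \<open>u\<close> in
  \<open>{1..int K}\<close>, so each \<open>u\<close> is reached exactly once for each of the
  \<open>A * B\<close> choices.\<close>

lemma sum_shift_average:
  fixes g :: "int \<Rightarrow> complex"
  assumes "A * B \<le> K"
  shows "of_nat (A * B) * (\<Sum>u\<in>{1..int K}. g u)
           = (\<Sum>(v, a)\<in>{1 - int K..int K} \<times> {1..int A}.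
                \<Sum>b\<in>{b \<in> {0..<int B}. v + a * b \<in> {1..int K}}. g (v + a * b))"
proof -
  let ?V = "{1 - int K..int K}"
  have shift: "(\<Sum>v\<in>?V. if v + a * b \<in> {1..int K} then g (v + a * b) else 0) = (\<Sum>u\<in>{1..int K}. g u)"
    if "a \<in> {1..int A}" "b \<in> {0..<int B}" for a b
  proof -
    have "a * b \<le> int A * int B" using that by (intro mult_mono) auto
    then have ab: "0 \<le> a * b" "a * b \<le> int K"
      using that assms by (auto simp flip: of_nat_mult)
    have "(\<Sum>v\<in>?V. if v + a * b \<in> {1..int K} then g (v + a * b) else 0)
        = (\<Sum>v\<in>{v \<in> ?V. v + a * b \<in> {1..int K}}. g (v + a * b))"
      by (rule sum.inter_filter[symmetric]) simp
    also have "\<dots> = (\<Sum>u\<in>{1..int K}. g u)"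
      by (rule sum.reindex_bij_witness[of _ "\<lambda>u. u - a * b" "\<lambda>v. v + a * b"]) (use ab in auto)
    finally show ?thesis .
  qed
  have "(\<Sum>(v, a)\<in>?V \<times> {1..int A}. \<Sum>b\<in>{b \<in> {0..<int B}. v + a * b \<in> {1..int K}}. g (v + a * b))
     = (\<Sum>v\<in>?V. \<Sum>a\<in>{1..int A}. \<Sum>b\<in>{0..<int B}. if v + a * b \<in> {1..int K} then g (v + a * b) else 0)"
    unfolding sum.cartesian_product[symmetric]
    by (intro sum.cong refl sum.inter_filter) simp
  also have "\<dots> = (\<Sum>a\<in>{1..int A}. \<Sum>b\<in>{0..<int B}. \<Sum>v\<in>?V. if v + a * b \<in> {1..int K} then g (v + a * b) else 0)"
    by (subst sum.swap, rule sum.cong[OF refl], subst sum.swap, rule refl)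
  also have "\<dots> = (\<Sum>a\<in>{1..int A}. \<Sum>b\<in>{0..<int B}. \<Sum>u\<in>{1..int K}. g u)"
    by (intro sum.cong refl shift)
  finally show ?thesis by simp
qed

text \<open>The shift argument with free parameters: averaging over shifts, Hoelder with weights
  \<open>gcd v a\<close>, the moment over \<open>t\<close> for each \<open>(v, a)\<close>, then
  grouping by the quotient and counting solutions over all residues \<open>s\<close>.\<close>

lemma reciprocal_moment_raw:
  fixes c :: "int \<Rightarrow> complex"
  assumes p: "prime p" "p > 2" and r: "1 \<le> r" "r < p" and B: "1 \<le> B" "B \<le> p"
    and AB: "1 \<le> A" "1 \<le> K" "A * B \<le> K" "2 * K * A < p" and c: "\<And>u. norm (c u) \<le> 1"
  shows "real (A * B) ^ (2 * r) *
           (\<Sum>t\<in>{0..<int p}. norm (\<Sum>u\<in>{1..int K}. c u * e_p p (t * recip p u)) ^ (2 * r))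
         \<le> (3 * real K * real A * harm A) ^ (2 * r - 1) *
            (real p * harm A * (real p * real B ^ r * real r ^ r + 2 * real r * real B ^ (2 * r)))"
proof -
  let ?I = "{1 - int K..int K} \<times> {1..int A}"
  define S where "S v a = {b \<in> {0..<int B}. v + a * b \<in> {1..int K}}" for v a
  define F where "F t v a = (\<Sum>b\<in>S v a. c (v + a * b) * e_p p (t * recip p (v + a * b)))" for t v a
  define W where "W t = (\<Sum>u\<in>{1..int K}. c u * e_p p (t * recip p u))" for t
  define G where "G = (\<Sum>(v, a)\<in>?I. real_of_int (gcd v a))"
  have "K \<le> 2 * K * A" "A \<le> 2 * K * A" using AB by auto
  then have KA: "K < p" "A < p" using AB by linarith+
  have G0: "G \<ge> 0" unfolding G_def by (intro sum_nonneg) auto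
  have GL: "G \<le> 3 * real K * real A * harm A"
  proof -
    have "A \<le> A * B" using B by simp
    then have "A \<le> K" using AB by linarith
    then show ?thesis using sum_gcd_le[of A K] by (simp add: G_def sum.cartesian_product)
  qed
  have W: "real (A * B) ^ (2 * r) * norm (W t) ^ (2 * r)
        \<le> G ^ (2 * r - 1) * (\<Sum>(v, a)\<in>?I. norm (F t v a) ^ (2 * r) / of_int (gcd v a))" for t
  proof -
    have "real (A * B) * norm (W t) = norm (of_nat (A * B) * W t)"
      by (simp add: norm_mult)
    also have "of_nat (A * B) * W t = (\<Sum>(v, a)\<in>?I. F t v a)"
      unfolding W_def F_def S_def by (rule sum_shift_average[OF AB(3)])
    also have "norm \<dots> \<le> (\<Sum>(v, a)\<in>?I. norm (F t v a))"
      by (rule sum_norm_le) auto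
    finally have "(real (A * B) * norm (W t)) ^ (2 * r) \<le> (\<Sum>(v, a)\<in>?I. norm (F t v a)) ^ (2 * r)"
      by (intro power_mono) auto
    also have "\<dots> \<le> (\<Sum>i\<in>?I. real_of_int (gcd (fst i) (snd i))) ^ (2 * r - 1) *
        (\<Sum>i\<in>?I. norm (F t (fst i) (snd i)) ^ (2 * r) / real_of_int (gcd (fst i) (snd i)) ^ (2 * r - 1))"
      unfolding case_prod_unfold
      by (rule weighted_power_mean) (use r in auto)
    \<comment> \<open>From the weight to the power \<open>2 * r - 1\<close> in the denominator only
      one factor is kept; this is already enough for the sum over a fibre of the quotient map to be
      harmonic.\<close>
    also have "\<dots> \<le> G ^ (2 * r - 1) * (\<Sum>(v, a)\<in>?I. norm (F t v a) ^ (2 * r) / of_int (gcd v a))"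
      unfolding G_def case_prod_unfold
    proof (intro mult_left_mono sum_mono divide_left_mono)
      fix i assume i: "i \<in> ?I"
      then have "gcd (fst i) (snd i) \<in> {1..int A}"
        by (intro gcd_in_range) auto
      then have g: "real_of_int (gcd (fst i) (snd i)) \<ge> 1"
        unfolding atLeastAtMost_iff by linarith
      then show "real_of_int (gcd (fst i) (snd i)) \<le> real_of_int (gcd (fst i) (snd i)) ^ (2 * r - 1)"
        by (intro self_le_power) (use r in auto)
      show "0 < real_of_int (gcd (fst i) (snd i)) ^ (2 * r - 1) * real_of_int (gcd (fst i) (snd i))"
        using g by (intro mult_pos_pos zero_less_power; linarith)
    qed (auto intro!: sum_nonneg zero_le_power)
    finally show ?thesis by (simp only: power_mult_distrib)
  qed
  have "real (A * B) ^ (2 * r) * (\<Sum>t\<in>{0..<int p}. norm (W t) ^ (2 * r))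
     \<le> (\<Sum>t\<in>{0..<int p}. G ^ (2 * r - 1) * (\<Sum>(v, a)\<in>?I. norm (F t v a) ^ (2 * r) / of_int (gcd v a)))"
    unfolding sum_distrib_left[of _ _ "{0..<int p}"] by (intro sum_mono W)
  also have "\<dots> = G ^ (2 * r - 1) * (\<Sum>i\<in>?I. (\<Sum>t\<in>{0..<int p}. norm (F t (fst i) (snd i)) ^ (2 * r)) / of_int (gcd (fst i) (snd i)))"
    unfolding sum_distrib_left[symmetric] case_prod_unfold
    by (subst sum.swap) (simp only: sum_divide_distrib)
  also have "\<dots> \<le> G ^ (2 * r - 1) * (\<Sum>i\<in>?I. (real p * real (card (recip_pairs p r B ((fst i * recip p (snd i)) mod int p)))) / of_int (gcd (fst i) (snd i)))"
  proof (intro mult_left_mono sum_mono divide_right_mono)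
    fix i assume i: "i \<in> ?I"
    have "\<not> int p dvd snd i"
      using i KA by (auto dest!: zdvd_imp_le)
    then show "(\<Sum>t\<in>{0..<int p}. norm (F t (fst i) (snd i)) ^ (2 * r)) \<le> real p * real (card (recip_pairs p r B ((fst i * recip p (snd i)) mod int p)))"
      unfolding F_def S_def by (intro shifted_moment_le p KA c)
  qed (use G0 in auto)
  also have "\<dots> = G ^ (2 * r - 1) * (real p * (\<Sum>(v, a)\<in>?I. real (card (recip_pairs p r B ((v * recip p a) mod int p))) / of_int (gcd v a)))"
    by (simp add: sum_distrib_left case_prod_unfold)
  also have "\<dots> \<le> G ^ (2 * r - 1) * (real p * (harm A * (\<Sum>s\<in>{0..<int p}. real (card (recip_pairs p r B s)))))"
    by (intro mult_left_mono sum_over_quotients_le p AB) (use G0 in auto)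
  also have "\<dots> \<le> (3 * real K * real A * harm A) ^ (2 * r - 1) * (real p * (harm A * (real p * real B ^ r * real r ^ r + 2 * real r * real B ^ (2 * r))))"
  proof (intro mult_mono power_mono GL G0 mult_left_mono)
    have "real (\<Sum>s\<in>{0..<int p}. card (recip_pairs p r B s)) \<le> real (p * B ^ r * r ^ r + 2 * r * B ^ (2 * r))"
      using sum_card_recip_pairs[OF p r(2) B(2)] of_nat_le_iff by blast
    then show "(\<Sum>s\<in>{0..<int p}. real (card (recip_pairs p r B s))) \<le> real p * real B ^ r * real r ^ r + 2 * real r * real B ^ (2 * r)"
      by simp
  qed (auto intro!: mult_nonneg_nonneg sum_nonneg harm_nonneg zero_le_power)
  finally show ?thesis by (simp only: W_def mult.assoc)
qed

text \<open>Choice of the parameters in the shift argument. Since the bound loses a factor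
  \<open>1 / A\<close>, the range \<open>A\<close> is taken as large as possible; the two
  constraints on it account for the two terms on the right.\<close>

lemma reciprocal_moment:
  fixes c :: "int \<Rightarrow> complex"
  assumes p: "prime p" "p > 2" and r: "1 \<le> r" "r < p"
    and K: "1 \<le> K" "2 * K < p" and c: "\<And>u. norm (c u) \<le> 1"
  shows "(\<Sum>t\<in>{0..<int p}. norm (\<Sum>u\<in>{1..int K}. c u * e_p p (t * recip p u)) ^ (2 * r))
         \<le> (4 * 3 ^ (2 * r - 1) * 4 ^ r * (real r ^ r + 2 * real r)) * (1 + ln (real p)) ^ (2 * r)
             * (real K ^ (2 * r - 2) * real p * real p powr (1 / real r) + real K ^ (2 * r))"
proof -
  define W where "W t = (\<Sum>u\<in>{1..int K}. c u * e_p p (t * recip p u))" for t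
  define M where "M = (\<Sum>t\<in>{0..<int p}. norm (W t) ^ (2 * r))"
  define D where "D = real r ^ r + 2 * real r"
  define L where "L = 1 + ln (real p)"
  define \<beta> where "\<beta> = real p powr (1 / real r)"
  \<comment> \<open>The size at which the terms \<open>p * B ^ r\<close> and
    \<open>B ^ (2 * r)\<close> of the solution count balance, both being of order
    \<open>p ^ 2\<close>.\<close>
  define B where "B = nat \<lfloor>\<beta>\<rfloor>"
  obtain m where m: "2 * r = Suc (Suc m)" using r by (cases r) auto
  have L: "L \<ge> 1" using p by (simp add: L_def)
  have D: "D \<ge> 1"
  proof -
    have "0 \<le> real r ^ r" "1 \<le> real r" using r by auto
    then show ?thesis unfolding D_def by linarith
  qed
  have \<beta>1: "\<beta> \<ge> 1" using p by (simp add: \<beta>_def ge_one_powr_ge_zero)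
  have \<beta>r: "\<beta> ^ r = real p"
    using p r by (simp add: \<beta>_def powr_powr flip: powr_realpow)
  have B1: "B \<ge> 1" using \<beta>1 by (simp add: B_def le_nat_iff)
  have Bb: "real B \<le> \<beta>" "\<beta> \<le> 2 * real B"
  proof -
    have e: "real B = of_int \<lfloor>\<beta>\<rfloor>" using \<beta>1 by (simp add: B_def)
    show "real B \<le> \<beta>" unfolding e by simp
    have "\<beta> < of_int \<lfloor>\<beta>\<rfloor> + 1" by linarith
    then show "\<beta> \<le> 2 * real B" using B1 unfolding e[symmetric] by linarith
  qed
  have Br: "real B ^ r \<le> real p"
    using power_mono[OF Bb(1), of r] by (simp add: \<beta>r)
  have Bp: "B \<le> p"
  proof -
    have "B ^ 1 \<le> B ^ r" using B1 r by (intro power_increasing) auto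
    also have "\<dots> \<le> p" using Br by (metis of_nat_le_iff of_nat_power)
    finally show ?thesis by simp
  qed
  have p2: "(real p)\<^sup>2 \<le> 4 ^ r * real B ^ (2 * r)"
  proof -
    have "(real p)\<^sup>2 = \<beta> ^ (2 * r)" by (simp add: \<beta>r power_even_eq)
    also have "\<dots> \<le> (2 * real B) ^ (2 * r)" using \<beta>1 Bb by (intro power_mono) auto
    finally show ?thesis by (simp add: power_mult_distrib power_mult)
  qed
  have main: "M \<le> 4 * 3 ^ (m + 1) * 4 ^ r * D * L ^ (m + 2) * (real K ^ m * real p * \<beta> + real K ^ (m + 2))"
  proof (cases "K < B")
    case True
    \<comment> \<open>For \<open>K < B\<close> no \<open>A \<ge> 1\<close> satisfies
      \<open>A * B \<le> K\<close>. Here \<open>m = 2 * r - 2\<close> factors are bounded trivially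
      by \<open>K\<close>, and Parseval applied to the remaining square contributes at most
      \<open>p * K\<close>, which is below \<open>p * \<beta>\<close>.\<close>
    have "M \<le> (\<Sum>t\<in>{0..<int p}. real K ^ m * (norm (W t))\<^sup>2)"
      unfolding M_def
    proof (rule sum_mono)
      fix t
      have "norm (W t) \<le> (\<Sum>u\<in>{1..int K}. 1)"
        unfolding W_def by (rule sum_norm_le) (simp add: norm_mult c)
      then have "norm (W t) ^ m \<le> real K ^ m" by (intro power_mono) auto
      then have "norm (W t) ^ m * (norm (W t))\<^sup>2 \<le> real K ^ m * (norm (W t))\<^sup>2"
        by (rule mult_right_mono) simp
      then show "norm (W t) ^ (2 * r) \<le> real K ^ m * (norm (W t))\<^sup>2"
        unfolding m by (simp add: power2_eq_square mult_ac)
    qed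
    also have "\<dots> = real K ^ m * (\<Sum>t\<in>{0..<int p}. (norm (W t))\<^sup>2)"
      by (simp add: sum_distrib_left)
    also have "(\<Sum>t\<in>{0..<int p}. (norm (W t))\<^sup>2) = real p * (\<Sum>u\<in>{1..int K}. (norm (c u))\<^sup>2)"
      unfolding W_def
    proof (rule sum_norm_e_p_square_inj)
      fix i j assume ij: "i \<in> {1..int K}" "j \<in> {1..int K}" "[recip p i = recip p j] (mod int p)"
      have nd: "\<not> int p dvd k" if "k \<in> {1..int K}" for k
        using that K zdvd_imp_le[of "int p" k] by auto
      have "[i = j] (mod int p)" by (rule recip_inj[OF p nd nd ij(3)]) (fact ij)+
      moreover have "0 \<le> k \<and> k < int p" if "k \<in> {1..int K}" for k
        using that K by simp
      ultimately show "i = j" using ij(1,2) cong_less_imp_eq_int by blast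
    qed (use p in auto)
    also have "(\<Sum>u\<in>{1..int K}. (norm (c u))\<^sup>2) \<le> (\<Sum>u\<in>{1..int K}. 1)"
      by (intro sum_mono power_le_one c) auto
    also have "(\<Sum>u\<in>{1..int K}. 1) \<le> \<beta>" using True Bb by simp
    finally have "M \<le> real K ^ m * (real p * \<beta>)" using K p by (simp add: mult_left_mono)
    also have "\<dots> \<le> 1 * (real K ^ m * real p * \<beta> + real K ^ (m + 2))" by simp
    also have "\<dots> \<le> 4 * 3 ^ (m + 1) * 4 ^ r * D * L ^ (m + 2) * (real K ^ m * real p * \<beta> + real K ^ (m + 2))"
    proof (rule mult_right_mono)
      have "1 \<le> (4 * 3 ^ (m + 1) * 4 ^ r :: real)"
        by (intro mult_ge1_I one_le_power) auto
      then show "1 \<le> 4 * 3 ^ (m + 1) * 4 ^ r * D * L ^ (m + 2)"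
        using D L by (intro mult_ge1_I one_le_power) auto
    qed (use \<beta>1 in auto)
    finally show ?thesis .
  next
    case False
    \<comment> \<open>The largest value compatible with \<open>A * B \<le> K\<close> and
      \<open>2 * K * A < p\<close>.\<close>
    define A where "A = min (K div B) ((p - 1) div (2 * K))"
    have A1: "A \<ge> 1"
    proof -
      have "K div B \<ge> 1" using False B1 by (simp add: Suc_leI div_greater_zero_iff)
      moreover have "(p - 1) div (2 * K) \<ge> 1" using K by (simp add: Suc_leI div_greater_zero_iff)
      ultimately show ?thesis by (simp add: A_def)
    qed
    have AB: "A * B \<le> K"
    proof -
      have "A * B \<le> (K div B) * B" by (intro mult_right_mono) (auto simp: A_def)
      also have "\<dots> \<le> K" by simp
      finally show ?thesis .
    qed
    have KA: "2 * K * A < p"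
    proof -
      have "2 * K * A \<le> 2 * K * ((p - 1) div (2 * K))" by (intro mult_left_mono) (auto simp: A_def)
      also have "\<dots> \<le> p - 1" by simp
      finally show ?thesis using p by linarith
    qed
    \<comment> \<open>Whichever constraint determines \<open>A\<close>, rounding down costs at most
      a factor two, because \<open>A \<ge> 1\<close>.\<close>
    have invA: "1 / real A \<le> 2 * real B / real K + 4 * real K / real p"
    proof (cases "A = K div B")
      case True
      have "K < (K div B) * B + B"
        using B1 by (metis add.commute add_less_cancel_left div_mult_mod_eq less_le_trans mod_less_divisor not_gr0 not_one_le_zero)
      also have "\<dots> \<le> 2 * A * B" using True A1 by simp
      finally have "real K \<le> 2 * real A * real B" by (metis less_imp_le of_nat_le_iff of_nat_mult of_nat_numeral)
      then have "1 / real A \<le> 2 * real B / real K" using A1 K by (simp add: field_simps)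
      then show ?thesis by (simp add: add_increasing2)
    next
      case False
      then have Ae: "A = (p - 1) div (2 * K)" by (auto simp: A_def min_def)
      have "p - 1 < ((p - 1) div (2 * K)) * (2 * K) + 2 * K"
        using K by (metis add_less_cancel_left div_mult_mod_eq mod_less_divisor mult_pos_pos pos2 less_le_trans zero_less_one)
      also have "\<dots> = 2 * K * (A + 1)" unfolding Ae[symmetric] by simp
      also have "\<dots> \<le> 2 * K * (2 * A)" using A1 by (intro mult_left_mono) auto
      finally have "p \<le> 4 * A * K" using p by (simp add: mult_ac)
      then have "real p \<le> 4 * real A * real K" by (metis of_nat_le_iff of_nat_mult of_nat_numeral)
      then have "1 / real A \<le> 4 * real K / real p" using A1 p by (simp add: field_simps)
      then show ?thesis by (simp add: add_increasing)
    qed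
    have HL: "harm A \<le> L"
    proof -
      have "A \<le> 2 * K * A" using K by simp
      then have "A \<le> p" using KA by linarith
      then have "ln (real A) \<le> ln (real p)" using A1 by simp
      then show ?thesis using harm_le_ln[OF A1] by (simp add: L_def)
    qed
    have H0: "(0::real) \<le> harm A" by (rule harm_nonneg)
    have "real (A * B) ^ (2 * r) * M \<le> (3 * real K * real A * harm A) ^ (2 * r - 1) *
            (real p * harm A * (real p * real B ^ r * real r ^ r + 2 * real r * real B ^ (2 * r)))"
      unfolding M_def W_def
      by (rule reciprocal_moment_raw[OF p r B1 Bp A1 K(1) AB KA c])
    also have "\<dots> \<le> (3 * real K * real A * L) ^ (2 * r - 1) * (real p * L * ((real p)\<^sup>2 * D))"
    proof (intro mult_mono power_mono mult_left_mono HL)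
      have "real p * real B ^ r * real r ^ r \<le> real p * real p * real r ^ r"
        using Br by (intro mult_mono) auto
      moreover have "real B ^ (2 * r) \<le> (real p)\<^sup>2"
        using power_mono[OF Br, of 2] by (simp add: power_even_eq)
      then have "2 * real r * real B ^ (2 * r) \<le> 2 * real r * (real p)\<^sup>2"
        by (intro mult_left_mono) auto
      ultimately show "real p * real B ^ r * real r ^ r + 2 * real r * real B ^ (2 * r) \<le> (real p)\<^sup>2 * D"
        by (simp add: D_def algebra_simps power2_eq_square)
    qed (use H0 L in auto)
    finally have 1: "real (A * B) ^ (2 * r) * M \<le> (3 * real K * real A * L) ^ (m + 1) * (real p * L * ((real p)\<^sup>2 * D))"
      by (simp add: m)
    have M0: "M \<ge> 0" unfolding M_def by (intro sum_nonneg) auto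
    \<comment> \<open>By \<open>p2\<close> the factor \<open>B ^ (2 * r)\<close> on the left is
      worth \<open>p ^ 2\<close> up to \<open>4 ^ r\<close>. It cancels the \<open>p ^ 2\<close> of
      the solution count, and all powers of \<open>A\<close> but one cancel as well.\<close>
    have "(real A ^ (m + 1) * (real p)\<^sup>2) * (real A * M) = real A ^ (2 * r) * ((real p)\<^sup>2 * M)"
      unfolding m by (simp add: mult_ac)
    also have "\<dots> \<le> real A ^ (2 * r) * ((4 ^ r * real B ^ (2 * r)) * M)"
      by (intro mult_left_mono mult_right_mono p2 M0) auto
    also have "\<dots> = 4 ^ r * (real (A * B) ^ (2 * r) * M)"
      by (simp add: power_mult_distrib mult_ac)
    also have "\<dots> \<le> 4 ^ r * ((3 * real K * real A * L) ^ (m + 1) * (real p * L * ((real p)\<^sup>2 * D)))"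
      using 1 by (intro mult_left_mono) auto
    also have "\<dots> = (real A ^ (m + 1) * (real p)\<^sup>2) * (3 ^ (m + 1) * 4 ^ r * D * L ^ (m + 2) * (real K ^ (m + 1) * real p))"
      by (simp add: power_mult_distrib mult_ac)
    finally have "real A * M \<le> 3 ^ (m + 1) * 4 ^ r * D * L ^ (m + 2) * (real K ^ (m + 1) * real p)"
      by (rule mult_left_le_imp_le) (use A1 p in auto)
    then have "M \<le> 3 ^ (m + 1) * 4 ^ r * D * L ^ (m + 2) * (real K ^ (m + 1) * real p) * (1 / real A)"
      using A1 by (simp add: field_simps)
    also have "\<dots> \<le> 3 ^ (m + 1) * 4 ^ r * D * L ^ (m + 2) * (real K ^ (m + 1) * real p) * (2 * real B / real K + 4 * real K / real p)"
      using D L by (intro mult_left_mono invA) auto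
    also have "\<dots> = 3 ^ (m + 1) * 4 ^ r * D * L ^ (m + 2) * (2 * (real K ^ m * real p * real B) + 4 * real K ^ (m + 2))"
      using K p by (simp add: field_simps)
    also have "\<dots> \<le> 3 ^ (m + 1) * 4 ^ r * D * L ^ (m + 2) * (4 * (real K ^ m * real p * \<beta> + real K ^ (m + 2)))"
    proof (rule mult_left_mono)
      have "real K ^ m * real p * real B \<le> real K ^ m * real p * \<beta>"
        using Bb by (intro mult_left_mono) auto
      moreover have "0 \<le> real K ^ m * real p * \<beta>" using \<beta>1 by simp
      ultimately show "2 * (real K ^ m * real p * real B) + 4 * real K ^ (m + 2)
          \<le> 4 * (real K ^ m * real p * \<beta> + real K ^ (m + 2))"
        unfolding distrib_left by linarith
    qed (use D L in auto)
    finally show ?thesis by (simp only: mult_ac)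
  qed
  have "2 * r - 1 = m + 1" "2 * r - 2 = m" "2 * r = m + 2" using m by auto
  then show ?thesis
    using main unfolding M_def W_def D_def L_def \<beta>_def by simp
qed

section \<open>Dyadic decomposition\<close>

lemma sum_dyadic:
  fixes f :: "int \<Rightarrow> 'a::comm_monoid_add"
  shows "(\<Sum>y\<in>{1..<2 ^ n}. f y) = (\<Sum>j<n. \<Sum>y\<in>{2 ^ j..<2 ^ Suc j}. f y)"
proof (induction n)
  case (Suc n)
  have "{1..<2 ^ Suc n} = {1..<2 ^ n} \<union> {2 ^ n..<2 ^ Suc n :: int}"
    by (rule ivl_disj_un_two(3)[symmetric]) auto
  then show ?case
    using Suc by (simp add: sum.union_disjoint ivl_disj_int_two(3) del: power_Suc)
qed simp

lemma norm_sum_power_le: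
  fixes f :: "nat \<Rightarrow> complex"
  assumes "n \<ge> 1"
  shows "norm (\<Sum>j<J. f j) ^ n \<le> real J ^ (n - 1) * (\<Sum>j<J. norm (f j) ^ n)"
proof -
  have "norm (\<Sum>j<J. f j) ^ n \<le> (\<Sum>j<J. norm (f j)) ^ n"
    by (intro power_mono norm_sum) auto
  also have "\<dots> \<le> (\<Sum>j<J. 1) ^ (n - 1) * (\<Sum>j<J. norm (f j) ^ n / 1 ^ (n - 1))"
    by (rule weighted_power_mean) (use assms in auto)
  finally show ?thesis by simp
qed

text \<open>On the block \<open>y\<close> is comparable to \<open>2 ^ j\<close>, so \<open>h\<close>
  is bounded there by \<open>\<mu>\<close>, the smaller of \<open>N\<close> and
  \<open>p / 2 ^ j\<close>. Dividing by \<open>\<mu>\<close> reduces to coefficients of modulus at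
  most one, and \<open>\<mu> * K \<le> 2 * p\<close> makes the result independent of
  \<open>j\<close>.\<close>

lemma dyadic_block_moment:
  fixes h :: "int \<Rightarrow> complex" and N :: nat
  assumes p: "prime p" "p > 2" and r: "1 \<le> r" "r < p"
    and P: "2 * P < p" and N: "1 \<le> N"
    and hN: "\<And>y. y \<in> {1..int P} \<Longrightarrow> norm (h y) \<le> real N"
    and hp: "\<And>y. y \<in> {1..int P} \<Longrightarrow> norm (h y) \<le> real p / of_int y"
    and j: "2 ^ j \<le> P"
  shows "(\<Sum>t\<in>{0..<int p}. norm (\<Sum>y\<in>{2 ^ j..<2 ^ Suc j}.
            if y \<le> int P then h y * e_p p (t * recip p y) else 0) ^ (2 * r))
         \<le> (4 * 3 ^ (2 * r - 1) * 4 ^ r * (real r ^ r + 2 * real r)) * (1 + ln (real p)) ^ (2 * r)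
             * ((2 * real p) ^ (2 * r) * (1 + (real N)\<^sup>2 / real p powr (1 - 1 / real r)))"
proof -
  define C where "C = 4 * 3 ^ (2 * r - 1) * 4 ^ r * (real r ^ r + 2 * real r)"
  define K where "K = min (2 ^ Suc j - 1) P"
  define \<mu> where "\<mu> = min (real N) (real p / 2 ^ j)"
  \<comment> \<open>Setting the coefficients to zero below \<open>2 ^ j\<close> turns the block into
    a sum over the initial segment \<open>{1..int K}\<close>.\<close>
  define c where "c u = (if 2 ^ j \<le> u \<and> u \<le> int P then h u / of_real \<mu> else 0)" for u
  obtain m where m: "2 * r = Suc (Suc m)" using r by (cases r) auto
  have \<mu>: "\<mu> > 0" using N p by (simp add: \<mu>_def)
  have K: "1 \<le> K" "2 * K < p"
  proof -
    have "1 \<le> (2::nat) ^ j" by simp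
    also have "\<dots> \<le> K" unfolding K_def power_Suc using j by linarith
    finally show "1 \<le> K" .
    have "K \<le> P" by (simp add: K_def)
    then show "2 * K < p" using P by linarith
  qed
  have K2: "real K \<le> 2 * 2 ^ j"
  proof -
    have "K \<le> 2 * 2 ^ j" unfolding K_def power_Suc by linarith
    then have "real K \<le> real (2 * 2 ^ j)" by (rule of_nat_mono)
    then show ?thesis by simp
  qed
  have c: "norm (c u) \<le> 1" for u
  proof (cases "2 ^ j \<le> u \<and> u \<le> int P")
    case True
    have "(1::int) \<le> 2 ^ j" by simp
    then have u: "u \<in> {1..int P}" using True by (simp del: one_le_power)
    have "real_of_int (2 ^ j) \<le> of_int u" using True by (intro of_int_le_iff[THEN iffD2]) blast
    then have "real p / of_int u \<le> real p / 2 ^ j" using u by (intro divide_left_mono) auto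
    then have "norm (h u) \<le> \<mu>" using hN[OF u] hp[OF u] by (simp add: \<mu>_def)
    then show ?thesis using \<mu> True by (simp add: c_def norm_divide)
  next
    case False
    then show ?thesis unfolding c_def if_not_P[OF False] by simp
  qed
  have eq: "(\<Sum>y\<in>{2 ^ j..<2 ^ Suc j}. if y \<le> int P then h y * e_p p (t * recip p y) else 0)
      = of_real \<mu> * (\<Sum>u\<in>{1..int K}. c u * e_p p (t * recip p u))" for t
  proof -
    have Kint: "int K = min (2 ^ Suc j - 1) (int P)"
    proof -
      have "int (2 ^ Suc j - 1) = int (2 ^ Suc j) - int 1" by (intro of_nat_diff one_le_power) simp
      then show ?thesis unfolding K_def of_nat_min by simp
    qed
    have one: "(1::int) \<le> 2 ^ j" by simp
    have "(\<Sum>y\<in>{2 ^ j..<2 ^ Suc j}. if y \<le> int P then h y * e_p p (t * recip p y) else 0)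
        = (\<Sum>y\<in>{y \<in> {2 ^ j..<2 ^ Suc j}. y \<le> int P}. h y * e_p p (t * recip p y))"
      by (rule sum.inter_filter[symmetric]) simp
    also have "\<dots> = (\<Sum>u\<in>{1..int K}. of_real \<mu> * (c u * e_p p (t * recip p u)))"
      by (rule sum.mono_neutral_cong_left)
         (use \<mu> one in \<open>auto simp: c_def Kint simp del: power_Suc one_le_power\<close>)
    finally show ?thesis by (simp add: sum_distrib_left)
  qed
  have \<mu>K: "\<mu> * real K \<le> 2 * real p"
  proof -
    have "\<mu> * real K \<le> (real p / 2 ^ j) * (2 * 2 ^ j)"
      using \<mu> K2 by (intro mult_mono) (auto simp: \<mu>_def)
    then show ?thesis by simp
  qed
  have p1: "real p powr (1 / real r) = real p / real p powr (1 - 1 / real r)"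
    using p by (simp add: powr_diff)
  have "(\<Sum>t\<in>{0..<int p}. norm (\<Sum>y\<in>{2 ^ j..<2 ^ Suc j}. if y \<le> int P then h y * e_p p (t * recip p y) else 0) ^ (2 * r))
     = \<mu> ^ (2 * r) * (\<Sum>t\<in>{0..<int p}. norm (\<Sum>u\<in>{1..int K}. c u * e_p p (t * recip p u)) ^ (2 * r))"
    unfolding eq norm_mult power_mult_distrib sum_distrib_left[symmetric] using \<mu> by simp
  also have "\<dots> \<le> \<mu> ^ (2 * r) * (C * (1 + ln (real p)) ^ (2 * r)
             * (real K ^ (2 * r - 2) * real p * real p powr (1 / real r) + real K ^ (2 * r)))"
    unfolding C_def using \<mu> by (intro mult_left_mono reciprocal_moment p r K c) auto
  also have "\<dots> = C * (1 + ln (real p)) ^ (2 * r) *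
       (\<mu>\<^sup>2 * (\<mu> * real K) ^ m * real p * real p powr (1 / real r) + (\<mu> * real K) ^ (2 * r))"
    unfolding m by (simp add: power_mult_distrib power2_eq_square algebra_simps)
  \<comment> \<open>In the first term two of the \<open>2 * r\<close> factors \<open>\<mu>\<close>
    are bounded by \<open>N\<close>; all others are paired with a factor \<open>K\<close>.\<close>
  also have "\<dots> \<le> C * (1 + ln (real p)) ^ (2 * r) *
       ((real N)\<^sup>2 * (2 * real p) ^ m * real p * real p powr (1 / real r) + (2 * real p) ^ (2 * r))"
  proof -
    have "\<mu>\<^sup>2 \<le> (real N)\<^sup>2" using \<mu> by (intro power_mono) (auto simp: \<mu>_def)
    moreover have pow: "(\<mu> * real K) ^ i \<le> (2 * real p) ^ i" for i
      using \<mu>K \<mu> by (intro power_mono) auto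
    ultimately have "\<mu>\<^sup>2 * (\<mu> * real K) ^ m \<le> (real N)\<^sup>2 * (2 * real p) ^ m"
      using \<mu> by (intro mult_mono) auto
    then have "\<mu>\<^sup>2 * (\<mu> * real K) ^ m * real p * real p powr (1 / real r) \<le> (real N)\<^sup>2 * (2 * real p) ^ m * real p * real p powr (1 / real r)"
      by (intro mult_right_mono) auto
    then show ?thesis
      using pow p by (intro mult_left_mono add_mono) (auto simp: C_def)
  qed
  \<comment> \<open>The quarter stems from writing \<open>(2 * p) ^ m\<close> as
    \<open>(2 * p) ^ (2 * r)\<close> divided by \<open>4 * p ^ 2\<close>.\<close>
  also have "\<dots> = C * (1 + ln (real p)) ^ (2 * r) *
       ((2 * real p) ^ (2 * r) * (1 + (real N)\<^sup>2 / real p powr (1 - 1 / real r) / 4))"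
    unfolding m p1 by (simp add: field_simps)
  also have "\<dots> \<le> C * (1 + ln (real p)) ^ (2 * r)
             * ((2 * real p) ^ (2 * r) * (1 + (real N)\<^sup>2 / real p powr (1 - 1 / real r)))"
  proof -
    have "x / 4 \<le> x" if "0 \<le> x" for x :: real using that by linarith
    moreover have "0 \<le> (real N)\<^sup>2 / real p powr (1 - 1 / real r)" by simp
    ultimately have "(real N)\<^sup>2 / real p powr (1 - 1 / real r) / 4 \<le> (real N)\<^sup>2 / real p powr (1 - 1 / real r)"
      by blast
    then show ?thesis
      using p by (intro mult_left_mono add_left_mono) (auto simp: C_def)
  qed
  finally show ?thesis unfolding C_def .
qed

text \<open>There are \<open>J \<le> 2 * L\<close> dyadic blocks. The power mean inequality and the
  sum over blocks cost \<open>J ^ (2 * r)\<close>, which doubles the exponent of the logarithm;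
  \<open>16 ^ r\<close> collects the factors two from \<open>2 * L\<close> and from
  \<open>2 * p\<close>.\<close>

lemma weighted_reciprocal_moment:
  fixes h :: "int \<Rightarrow> complex" and N :: nat
  assumes p: "prime p" "p > 2" and r: "1 \<le> r" "r < p"
    and P: "1 \<le> P" "2 * P < p" and N: "1 \<le> N"
    and hN: "\<And>y. y \<in> {1..int P} \<Longrightarrow> norm (h y) \<le> real N"
    and hp: "\<And>y. y \<in> {1..int P} \<Longrightarrow> norm (h y) \<le> real p / of_int y"
  shows "(\<Sum>t\<in>{0..<int p}. norm (\<Sum>y\<in>{1..int P}. h y * e_p p (t * recip p y)) ^ (2 * r))
         \<le> (4 * 3 ^ (2 * r - 1) * 4 ^ r * (real r ^ r + 2 * real r)) * 16 ^ r * (1 + ln (real p)) ^ (4 * r)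
             * real p ^ (2 * r) * (1 + (real N)\<^sup>2 / real p powr (1 - 1 / real r))"
proof -
  define C where "C = 4 * 3 ^ (2 * r - 1) * 4 ^ r * (real r ^ r + 2 * real r)"
  define L where "L = 1 + ln (real p)"
  define X where "X = 1 + (real N)\<^sup>2 / real p powr (1 - 1 / real r)"
  obtain n where n: "2 ^ n \<le> P" "P < 2 ^ (n + 1)"
    using ex_power_ivl1[of 2 P] P by auto
  define J where "J = n + 1"
  define T where "T t j = (\<Sum>y\<in>{2 ^ j..<2 ^ Suc j}. if y \<le> int P then h y * e_p p (t * recip p y) else 0)" for t j
  have L: "L \<ge> 1" using p by (simp add: L_def)
  have X: "X \<ge> 1" by (simp add: X_def)
  have C: "C \<ge> 0" by (simp add: C_def)
  have JL: "real J \<le> 2 * L"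
  proof -
    have "2 ^ n \<le> p" using n P by linarith
    then have "real (2 ^ n) \<le> real p" by (rule of_nat_mono)
    then have "ln (2 ^ n) \<le> ln (real p)" using p by (subst ln_le_cancel_iff) auto
    then have "real n * ln 2 \<le> ln (real p)" by (simp add: ln_realpow)
    moreover have "1 / 2 \<le> ln (2::real)"
      using exp_half_le2 by (subst ln_ge_iff) auto
    then have "real n * (1 / 2) \<le> real n * ln 2"
      by (rule mult_left_mono) simp
    ultimately show ?thesis by (simp add: J_def L_def)
  qed
  have split: "(\<Sum>y\<in>{1..int P}. h y * e_p p (t * recip p y)) = (\<Sum>j<J. T t j)" for t
  proof -
    have "int P < int (2 ^ (n + 1))" using n(2) by (simp only: of_nat_less_iff)
    then have PJ: "int P < 2 ^ J" by (simp add: J_def)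
    have sub: "{1..int P} \<subseteq> {1..<2 ^ J}"
    proof
      fix y assume "y \<in> {1..int P}"
      then show "y \<in> {1..<2 ^ J}" unfolding atLeastAtMost_iff atLeastLessThan_iff using PJ by linarith
    qed
    have "(\<Sum>y\<in>{1..int P}. h y * e_p p (t * recip p y))
        = (\<Sum>y\<in>{1..<2 ^ J}. if y \<le> int P then h y * e_p p (t * recip p y) else 0)"
      by (rule sum.mono_neutral_cong_left) (use sub in auto)
    then show ?thesis unfolding T_def sum_dyadic .
  qed
  have "(\<Sum>t\<in>{0..<int p}. norm (\<Sum>y\<in>{1..int P}. h y * e_p p (t * recip p y)) ^ (2 * r))
     \<le> (\<Sum>t\<in>{0..<int p}. real J ^ (2 * r - 1) * (\<Sum>j<J. norm (T t j) ^ (2 * r)))"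
    unfolding split by (intro sum_mono norm_sum_power_le) (use r in auto)
  also have "\<dots> = real J ^ (2 * r - 1) * (\<Sum>j<J. \<Sum>t\<in>{0..<int p}. norm (T t j) ^ (2 * r))"
    by (subst sum.swap) (simp add: sum_distrib_left)
  also have "\<dots> \<le> real J ^ (2 * r - 1) * (\<Sum>j<J. C * L ^ (2 * r) * ((2 * real p) ^ (2 * r) * X))"
  proof (intro mult_left_mono sum_mono)
    fix j assume "j \<in> {..<J}"
    then have "(2::nat) ^ j \<le> 2 ^ n" by (intro power_increasing) (auto simp: J_def)
    then have "2 ^ j \<le> P" using n by linarith
    then show "(\<Sum>t\<in>{0..<int p}. norm (T t j) ^ (2 * r)) \<le> C * L ^ (2 * r) * ((2 * real p) ^ (2 * r) * X)"
      unfolding T_def C_def L_def X_def by (intro dyadic_block_moment p r P N hN hp)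
  qed auto
  also have "\<dots> = real J ^ (2 * r) * (C * L ^ (2 * r) * ((2 * real p) ^ (2 * r) * X))"
    using r by (simp add: power_eq_if[of _ "2 * r"])
  also have "\<dots> \<le> (2 * L) ^ (2 * r) * (C * L ^ (2 * r) * ((2 * real p) ^ (2 * r) * X))"
    using JL C L X by (intro mult_right_mono power_mono) auto
  also have "\<dots> = C * 16 ^ r * L ^ (4 * r) * real p ^ (2 * r) * X"
  proof -
    have "(2::real) ^ (2 * r) * 2 ^ (2 * r) = 16 ^ r"
      by (simp add: power_mult flip: power_mult_distrib)
    moreover have "L ^ (2 * r) * L ^ (2 * r) = L ^ (4 * r)" by (simp flip: power_add)
    ultimately show ?thesis by (simp add: power_mult_distrib mult_ac)
  qed
  finally show ?thesis unfolding C_def L_def X_def .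
qed

section \<open>Averages of Kloosterman sums\<close>

lemma Fp_star_not_dvd: "y \<in> Fp_star p \<Longrightarrow> \<not> int p dvd y"
  using zdvd_imp_le[of "int p" y] by (auto simp: Fp_star_def)

lemma modular_inverse_Fp_star:
  assumes p: "prime p" and y: "y \<in> Fp_star p"
  shows "modular_inverse (int p) y \<in> Fp_star p"
    and "modular_inverse (int p) (modular_inverse (int p) y) = y"
proof -
  have co: "coprime y (int p)"
    using p Fp_star_not_dvd[OF y] by (metis coprime_commute prime_imp_coprime prime_nat_int_transfer)
  have p1: "int p > 1" using prime_gt_1_nat[OF p] by simp
  have "modular_inverse (int p) y > 0" "modular_inverse (int p) y < int p"
    using mult_modular_inverse_int_pos[OF p1 co] modular_inverse_int_less p1 by auto
  then show "modular_inverse (int p) y \<in> Fp_star p" by (simp add: Fp_star_def)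
  show "modular_inverse (int p) (modular_inverse (int p) y) = y"
    by (rule modular_inverse_int_eqI) (use y cong_modular_inverse2[OF co] in \<open>auto simp: Fp_star_def\<close>)
qed

lemma sum_Kloosterman:
  assumes p: "prime p" "p > 2"
  shows "(\<Sum>n\<in>J. Kloosterman p l n) = (\<Sum>y\<in>Fp_star p. (\<Sum>n\<in>J. e_p p (n * y)) * e_p p (l * recip p y))"
proof -
  have "Kloosterman p l n = (\<Sum>y\<in>Fp_star p. e_p p (n * y) * e_p p (l * recip p y))" for n
  proof -
    have "Kloosterman p l n = (\<Sum>y\<in>Fp_star p. e_p p (l * modular_inverse (int p) y + n * y))"
      unfolding Kloosterman_def
      by (rule sum.reindex_bij_witness[of _ "modular_inverse (int p)" "modular_inverse (int p)"])
         (auto simp: modular_inverse_Fp_star[OF p(1)])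
    also have "\<dots> = (\<Sum>y\<in>Fp_star p. e_p p (n * y) * e_p p (l * recip p y))"
    proof (rule sum.cong[OF refl])
      fix y assume "y \<in> Fp_star p"
      then have "[l * modular_inverse (int p) y = l * recip p y] (mod int p)"
        by (intro cong_mult cong_refl modular_inverse_cong_recip p Fp_star_not_dvd)
      then have "e_p p (l * modular_inverse (int p) y) = e_p p (l * recip p y)"
        by (rule e_p_cong[rotated]) (use p in simp)
      then show "e_p p (l * modular_inverse (int p) y + n * y) = e_p p (n * y) * e_p p (l * recip p y)"
        by (simp add: e_p_add)
    qed
    finally show ?thesis .
  qed
  then show ?thesis
    by (simp add: sum_distrib_right sum.swap[of _ "Fp_star p" J])
qed

text \<open>The moment bounds for reciprocals require \<open>2 * P < p\<close>, so the residues
  above \<open>p / 2\<close> are written as \<open>p - y\<close>. As \<open>recip\<close> is odd,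
  this conjugates the phase; the outer conjugation restores it, and both halves have the same
  shape.\<close>

lemma sum_Kloosterman_halves:
  assumes p: "prime p" "p > 2"
  defines "P \<equiv> (p - 1) div 2"
  defines "G \<equiv> \<lambda>J y. \<Sum>n\<in>J. e_p p (n * y)"
  shows "(\<Sum>n\<in>J. Kloosterman p l n)
           = (\<Sum>y\<in>{1..int P}. G J y * e_p p (l * recip p y))
             + cnj (\<Sum>y\<in>{1..int P}. cnj (G J (- y)) * e_p p (l * recip p y))"
proof -
  have pP: "int p = 2 * int P + 1"
    using prime_odd_nat[OF p] p(2) by (auto simp: P_def elim!: oddE)
  let ?f = "\<lambda>y. G J y * e_p p (l * recip p y)"
  have "(\<Sum>y\<in>Fp_star p. ?f y) = (\<Sum>y\<in>{1..int P}. ?f y) + (\<Sum>y\<in>{int P + 1..2 * int P}. ?f y)"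
  proof -
    have "Fp_star p = {1..int P} \<union> {int P + 1..2 * int P}" by (auto simp: Fp_star_def pP)
    then show ?thesis by (simp add: sum.union_disjoint)
  qed
  also have "(\<Sum>y\<in>{int P + 1..2 * int P}. ?f y) = (\<Sum>y\<in>{1..int P}. ?f (int p - y))"
    by (rule sum.reindex_bij_witness[of _ "\<lambda>y. int p - y" "\<lambda>y. int p - y"]) (auto simp: pP)
  also have "\<dots> = (\<Sum>y\<in>{1..int P}. G J (- y) * cnj (e_p p (l * recip p y)))"
  proof (rule sum.cong[OF refl])
    fix y
    have neg: "[int p - y = - y] (mod int p)" by (simp add: cong_iff_dvd_diff)
    have "G J (int p - y) = G J (- y)"
      unfolding G_def by (intro sum.cong refl e_p_cong cong_mult cong_refl neg) (use p in simp)
    moreover have "[l * recip p (int p - y) = - (l * recip p y)] (mod int p)"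
      using cong_mult[OF cong_refl recip_cong[OF neg]] by (simp add: recip_minus[OF p])
    then have "e_p p (l * recip p (int p - y)) = cnj (e_p p (l * recip p y))"
      unfolding e_p_minus[symmetric] by (rule e_p_cong[rotated]) (use p in simp)
    ultimately show "?f (int p - y) = G J (- y) * cnj (e_p p (l * recip p y))" by simp
  qed
  finally show ?thesis
    by (simp add: sum_Kloosterman[OF p] G_def)
qed

section \<open>Geometric sums over intervals\<close>

lemma norm_e_p_minus_1_ge:
  assumes "y \<ge> 1" "2 * y \<le> int p"
  shows "norm (e_p p y - 1) \<ge> 2 * of_int y / real p"
proof -
  define x where "x = pi * of_int y / real p"
  have p: "real p > 0" using assms by (cases "p = 0") auto
  have y: "2 * real_of_int y \<le> real p" using assms(2) by linarith
  have x: "0 \<le> x" "x \<le> pi / 2"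
    using assms(1) p y by (auto simp: x_def field_simps)
  \<comment> \<open>As \<open>pi < 16 / 5\<close>, one has \<open>x * x < 3\<close> on the range, so
    the cubic error in the sine is at most half of \<open>x\<close>. The resulting weak form of
    Jordan's inequality suffices because \<open>pi > 2\<close>.\<close>
  have "pi\<^sup>2 \<le> (16 / 5)\<^sup>2"
    using pi_approx by (intro power_mono) auto
  then have "x\<^sup>2 \<le> 64 / 25"
    using power_mono[OF x(2,1), of 2] by (simp add: power_divide)
  then have "x * x\<^sup>2 \<le> x * (64 / 25)" using x by (intro mult_left_mono)
  then have x3: "x ^ 3 \<le> x * (64 / 25)" by (simp add: power3_eq_cube power2_eq_square mult.assoc)
  have "\<bar>sin x - x\<bar> \<le> x ^ 3 / 6"
    using Maclaurin_sin_bound[of x 3] x by (simp add: sin_coeff_def eval_nat_numeral)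
  then have "sin x \<ge> x / 2" using x3 x by linarith
  moreover have "2 * of_int y / real p \<le> x"
    using pi_gt3 p assms(1) by (simp add: x_def field_simps)
  moreover have "norm (e_p p y - 1) = 2 * \<bar>sin x\<bar>"
    using dist_exp_i_1[of "2 * x"] by (simp add: e_p_eq_cis cis_conv_exp x_def mult_ac)
  ultimately show ?thesis using abs_ge_self[of "sin x"] by linarith
qed

text \<open>Since \<open>N \<le> p\<close>, reduction modulo \<open>p\<close> merges no two of the
  consecutive integers, and by periodicity the sum is a geometric one up to a factor of modulus
  one.\<close>

lemma interval_exponential_sum:
  assumes J: "interval_mod p N J" and N: "N \<le> p" "p > 0"
  shows "\<exists>a. (\<Sum>n\<in>J. e_p p (n * y)) = e_p p (a * y) * (\<Sum>k<N. e_p p y ^ k)"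
proof -
  obtain a where a: "J = (\<lambda>k. k mod int p) ` {a + 1..a + int N}"
    using J by (auto simp: interval_mod_def)
  have "inj_on (\<lambda>k. k mod int p) {a + 1..a + int N}"
  proof (rule inj_onI)
    fix k k' assume *: "k \<in> {a + 1..a + int N}" "k' \<in> {a + 1..a + int N}" "k mod int p = k' mod int p"
    then have "int p dvd k - k'" by (simp add: mod_eq_dvd_iff)
    moreover have "\<bar>k - k'\<bar> < int p" using * N by auto
    ultimately show "k = k'" by (metis dvd_imp_le_int abs_of_nat eq_iff_diff_eq_0 not_le)
  qed
  then have "(\<Sum>n\<in>J. e_p p (n * y)) = (\<Sum>k\<in>{a + 1..a + int N}. e_p p ((k mod int p) * y))"
    unfolding a by (simp add: sum.reindex)
  also have "\<dots> = (\<Sum>k\<in>{a + 1..a + int N}. e_p p (k * y))"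
    by (intro sum.cong refl e_p_cong cong_mult) (use N in \<open>auto simp: cong_def\<close>)
  also have "\<dots> = (\<Sum>k<N. e_p p ((a + 1 + int k) * y))"
    by (rule sum.reindex_bij_witness[of _ "\<lambda>k. a + 1 + int k" "\<lambda>k. nat (k - a - 1)"]) auto
  also have "\<dots> = e_p p ((a + 1) * y) * (\<Sum>k<N. e_p p y ^ k)"
    by (simp add: sum_distrib_left distrib_right e_p_add e_p_power)
  finally show ?thesis by blast
qed

lemma interval_exponential_sum_le:
  assumes J: "interval_mod p N J" and N: "N \<le> p" "p > 0"
  shows "norm (\<Sum>n\<in>J. e_p p (n * y)) \<le> real N"
    and "\<lbrakk>1 \<le> \<bar>y\<bar>; 2 * \<bar>y\<bar> \<le> int p\<rbrakk> \<Longrightarrow> norm (\<Sum>n\<in>J. e_p p (n * y)) \<le> real p / of_int \<bar>y\<bar>"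
proof -
  obtain a where a: "(\<Sum>n\<in>J. e_p p (n * y)) = e_p p (a * y) * (\<Sum>k<N. e_p p y ^ k)"
    using interval_exponential_sum[OF J N] by blast
  have eq: "norm (\<Sum>n\<in>J. e_p p (n * y)) = norm (\<Sum>k<N. e_p p y ^ k)"
    unfolding a by (simp add: norm_mult)
  have "norm (\<Sum>k<N. e_p p y ^ k) \<le> (\<Sum>k<N. 1)"
    by (rule sum_norm_le) (simp add: norm_power)
  then show "norm (\<Sum>n\<in>J. e_p p (n * y)) \<le> real N" by (simp add: eq)
  assume y: "1 \<le> \<bar>y\<bar>" "2 * \<bar>y\<bar> \<le> int p"
  have "norm (e_p p y - 1) = norm (e_p p \<bar>y\<bar> - 1)"
  proof (cases "y \<ge> 0")
    case False
    then have "e_p p \<bar>y\<bar> - 1 = cnj (e_p p y - 1)" by (simp add: e_p_minus)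
    then show ?thesis by (metis complex_mod_cnj)
  qed simp
  then have lb: "norm (e_p p y - 1) \<ge> 2 * of_int \<bar>y\<bar> / real p"
    using norm_e_p_minus_1_ge[OF y] by simp
  have pos: "2 * real_of_int \<bar>y\<bar> / real p > 0" using y N by (intro divide_pos_pos) auto
  then have ne: "e_p p y \<noteq> 1" using lb by auto
  have "norm (\<Sum>k<N. e_p p y ^ k) = norm (e_p p y ^ N - 1) / norm (e_p p y - 1)"
    using ne by (simp add: geometric_sum norm_divide)
  also have "\<dots> \<le> 2 / (2 * of_int \<bar>y\<bar> / real p)"
  proof (intro frac_le lb pos)
    show "norm (e_p p y ^ N - 1) \<le> 2"
      using norm_triangle_ineq4[of "e_p p y ^ N" 1] by (simp add: norm_power)
  qed auto
  finally show "norm (\<Sum>n\<in>J. e_p p (n * y)) \<le> real p / of_int \<bar>y\<bar>" by (simp add: eq)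
qed

text \<open>Parseval is used twice, each time gaining a factor \<open>p\<close>: over
  \<open>l\<close>, where the frequencies \<open>recip p y\<close> are distinct, and then over
  \<open>y\<close>, where the frequencies are the elements of \<open>J\<close>.\<close>

lemma Kloosterman_interval_second_moment:
  assumes p: "prime p" "p > 2" and J: "J \<subseteq> Fp_star p"
  shows "(\<Sum>l\<in>Fp_star p. (norm (\<Sum>n\<in>J. Kloosterman p l n))\<^sup>2) \<le> (real p)\<^sup>2 * real (card J)"
proof -
  have sub: "Fp_star p \<subseteq> {0..<int p}" by (auto simp: Fp_star_def)
  have fin: "finite (Fp_star p)" by (simp add: Fp_star_def)
  have inj: "i = j" if "i \<in> Fp_star p" "j \<in> Fp_star p" "[i = j] (mod int p)" for i j
    using that sub cong_less_imp_eq_int[of i "int p" j] by (auto simp: Fp_star_def)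
  have "(\<Sum>l\<in>Fp_star p. (norm (\<Sum>n\<in>J. Kloosterman p l n))\<^sup>2)
      \<le> (\<Sum>l\<in>{0..<int p}. (norm (\<Sum>y\<in>Fp_star p. (\<Sum>n\<in>J. e_p p (n * y)) * e_p p (l * recip p y)))\<^sup>2)"
    unfolding sum_Kloosterman[OF p] by (rule sum_mono2) (use sub in auto)
  also have "\<dots> = real p * (\<Sum>y\<in>Fp_star p. (norm (\<Sum>n\<in>J. e_p p (n * y)))\<^sup>2)"
  proof (rule sum_norm_e_p_square_inj)
    fix i j assume ij: "i \<in> Fp_star p" "j \<in> Fp_star p" "[recip p i = recip p j] (mod int p)"
    show "i = j"
      by (intro inj ij recip_inj[OF p _ _ ij(3)] Fp_star_not_dvd)
  qed (use p fin in auto)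
  also have "\<dots> \<le> real p * (\<Sum>y\<in>{0..<int p}. (norm (\<Sum>n\<in>J. 1 * e_p p (y * n)))\<^sup>2)"
    by (intro mult_left_mono) (use sub in \<open>auto simp: mult.commute intro!: sum_mono2\<close>)
  also have "(\<Sum>y\<in>{0..<int p}. (norm (\<Sum>n\<in>J. 1 * e_p p (y * n)))\<^sup>2) = real p * (\<Sum>n\<in>J. (norm (1::complex))\<^sup>2)"
    by (rule sum_norm_e_p_square_inj) (use p fin J inj in \<open>auto dest: finite_subset\<close>)
  finally show ?thesis by (simp add: power2_eq_square)
qed

text \<open>Taking absolute values in both halves leaves two harmonic sums.\<close>

lemma norm_Kloosterman_interval_le:
  assumes p: "prime p" "p > 2" and J: "interval_mod p N J" "N \<le> p"
  shows "norm (\<Sum>n\<in>J. Kloosterman p l n) \<le> 2 * real p * (1 + ln (real p))"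
proof -
  let ?P = "(p - 1) div 2"
  have P: "1 \<le> ?P" "2 * ?P < p" using p by auto
  have "norm (\<Sum>n\<in>J. e_p p (n * y)) \<le> real p / of_int \<bar>y\<bar>" if "1 \<le> \<bar>y\<bar>" "\<bar>y\<bar> \<le> int ?P" for y
    using that P p by (intro interval_exponential_sum_le[OF J]) auto
  then have G: "norm (\<Sum>n\<in>J. e_p p (n * y)) \<le> real p / of_int y"
    "norm (cnj (\<Sum>n\<in>J. e_p p (n * (- y)))) \<le> real p / of_int y" if "y \<in> {1..int ?P}" for y
    using that unfolding complex_mod_cnj by (metis abs_minus_cancel abs_of_nonneg atLeastAtMost_iff order_trans zero_le_one)+
  have "norm (\<Sum>y\<in>{1..int ?P}. h y * e_p p (l * recip p y)) \<le> real p * (1 + ln (real p))"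
    if h: "\<And>y. y \<in> {1..int ?P} \<Longrightarrow> norm (h y) \<le> real p / of_int y" for h
  proof -
    have "norm (\<Sum>y\<in>{1..int ?P}. h y * e_p p (l * recip p y)) \<le> (\<Sum>y\<in>{1..int ?P}. real p * (1 / of_int y))"
      by (rule sum_norm_le) (use h in \<open>simp add: norm_mult\<close>)
    also have "\<dots> = real p * harm ?P"
      by (simp only: sum_distrib_left[symmetric] sum_inverse_int_eq_harm)
    also have "\<dots> \<le> real p * (1 + ln (real ?P))"
      by (intro mult_left_mono harm_le_ln P) auto
    also have "\<dots> \<le> real p * (1 + ln (real p))"
      using P by (intro mult_left_mono add_left_mono) (auto simp del: of_nat_div)
    finally show ?thesis .
  qed
  note U = this[OF G(1)] and V = this[OF G(2)]
  show ?thesis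
    unfolding sum_Kloosterman_halves[OF p]
    by (rule order_trans[OF norm_triangle_ineq]) (use U V in \<open>simp only: complex_mod_cnj, linarith\<close>)
qed

text \<open>Each half obeys the weighted moment bound. Recombining them costs
  \<open>2 ^ (2 * r - 1)\<close> by the power mean inequality and a further two for the two halves,
  which raises \<open>16 ^ r\<close> to \<open>64 ^ r\<close>.\<close>

lemma Kloosterman_interval_moment:
  assumes p: "prime p" "p > 2" and r: "1 \<le> r" "r < p"
    and J: "interval_mod p N J" "N \<le> p" "1 \<le> N"
  shows "(\<Sum>l\<in>Fp_star p. norm (\<Sum>n\<in>J. Kloosterman p l n) ^ (2 * r))
         \<le> (4 * 3 ^ (2 * r - 1) * 4 ^ r * (real r ^ r + 2 * real r)) * 64 ^ r * (1 + ln (real p)) ^ (4 * r)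
             * real p ^ (2 * r) * (1 + (real N)\<^sup>2 / real p powr (1 - 1 / real r))"
proof -
  let ?P = "(p - 1) div 2"
  define Y where "Y = (4 * 3 ^ (2 * r - 1) * 4 ^ r * (real r ^ r + 2 * real r)) * 16 ^ r * (1 + ln (real p)) ^ (4 * r)
             * real p ^ (2 * r) * (1 + (real N)\<^sup>2 / real p powr (1 - 1 / real r))"
  define U where "U l = (\<Sum>y\<in>{1..int ?P}. (\<Sum>n\<in>J. e_p p (n * y)) * e_p p (l * recip p y))" for l
  define V where "V l = (\<Sum>y\<in>{1..int ?P}. cnj (\<Sum>n\<in>J. e_p p (n * (- y))) * e_p p (l * recip p y))" for l
  have P: "1 \<le> ?P" "2 * ?P < p" using p by auto
  have "norm (\<Sum>n\<in>J. e_p p (n * y)) \<le> real p / of_int \<bar>y\<bar>" if "1 \<le> \<bar>y\<bar>" "\<bar>y\<bar> \<le> int ?P" for y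
    using that P p by (intro interval_exponential_sum_le[OF J(1,2)]) auto
  then have G: "norm (\<Sum>n\<in>J. e_p p (n * y)) \<le> real p / of_int y"
    "norm (cnj (\<Sum>n\<in>J. e_p p (n * (- y)))) \<le> real p / of_int y" if "y \<in> {1..int ?P}" for y
    using that unfolding complex_mod_cnj by (metis abs_minus_cancel abs_of_nonneg atLeastAtMost_iff order_trans zero_le_one)+
  have GN: "norm (\<Sum>n\<in>J. e_p p (n * y)) \<le> real N" "norm (cnj (\<Sum>n\<in>J. e_p p (n * (- y)))) \<le> real N" for y
    unfolding complex_mod_cnj using p by (intro interval_exponential_sum_le(1)[OF J(1,2)]; simp)+
  have UV: "(\<Sum>t\<in>{0..<int p}. norm (U t) ^ (2 * r)) \<le> Y" "(\<Sum>t\<in>{0..<int p}. norm (V t) ^ (2 * r)) \<le> Y"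
    unfolding U_def V_def Y_def
    using weighted_reciprocal_moment[OF p r P J(3) GN(1) G(1)]
      weighted_reciprocal_moment[OF p r P J(3) GN(2) G(2)] by blast+
  have pw: "norm (\<Sum>n\<in>J. Kloosterman p l n) ^ (2 * r) \<le> 2 ^ (2 * r - 1) * (norm (U l) ^ (2 * r) + norm (V l) ^ (2 * r))" for l
    unfolding sum_Kloosterman_halves[OF p] U_def[symmetric] V_def[symmetric]
    using norm_sum_power_le[of "2 * r" "\<lambda>j. if j = 0 then U l else cnj (V l)" 2] r
    by (simp add: numeral_2_eq_2)
  have "(\<Sum>l\<in>Fp_star p. norm (\<Sum>n\<in>J. Kloosterman p l n) ^ (2 * r))
      \<le> (\<Sum>l\<in>{0..<int p}. norm (\<Sum>n\<in>J. Kloosterman p l n) ^ (2 * r))"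
    by (rule sum_mono2) (auto simp: Fp_star_def)
  also have "\<dots> \<le> (\<Sum>l\<in>{0..<int p}. 2 ^ (2 * r - 1) * (norm (U l) ^ (2 * r) + norm (V l) ^ (2 * r)))"
    by (intro sum_mono pw)
  also have "\<dots> = 2 ^ (2 * r - 1) * ((\<Sum>l\<in>{0..<int p}. norm (U l) ^ (2 * r)) + (\<Sum>l\<in>{0..<int p}. norm (V l) ^ (2 * r)))"
    by (simp only: sum_distrib_left[symmetric] sum.distrib)
  also have "\<dots> \<le> 2 ^ (2 * r - 1) * (Y + Y)"
    by (intro mult_left_mono add_mono UV) auto
  also have "\<dots> = 2 ^ (2 * r) * Y"
    using r by (simp add: power_eq_if[of _ "2 * r"])
  also have "2 ^ (2 * r) = (4::real) ^ r" by (simp add: power_mult)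
  also have "4 ^ r * Y = (4 * 3 ^ (2 * r - 1) * 4 ^ r * (real r ^ r + 2 * real r)) * (4 ^ r * 16 ^ r) * (1 + ln (real p)) ^ (4 * r)
             * real p ^ (2 * r) * (1 + (real N)\<^sup>2 / real p powr (1 - 1 / real r))"
    by (simp only: Y_def mult_ac)
  also have "(4::real) ^ r * 16 ^ r = 64 ^ r" by (simp flip: power_mult_distrib)
  finally show ?thesis .
qed

section \<open>Interpolation\<close>

text \<open>Hoelder's inequality in its log-convex form, proved termwise: Young's inequality is
  applied after normalising the two sums by \<open>U\<close> and \<open>V\<close>.\<close>

lemma powr_sum_interpolation:
  fixes z :: "'a \<Rightarrow> real"
  assumes z: "\<And>i. i \<in> I \<Longrightarrow> 0 \<le> z i"
    and U: "(\<Sum>i\<in>I. z i powr a) \<le> U" "U > 0" and V: "(\<Sum>i\<in>I. z i powr b) \<le> V" "V > 0"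
    and \<theta>: "0 \<le> \<theta>" "\<theta> \<le> 1"
  shows "(\<Sum>i\<in>I. z i powr ((1 - \<theta>) * a + \<theta> * b)) \<le> U powr (1 - \<theta>) * V powr \<theta>"
proof -
  let ?W = "U powr (1 - \<theta>) * V powr \<theta>"
  have "(\<Sum>i\<in>I. z i powr ((1 - \<theta>) * a + \<theta> * b))
      \<le> (\<Sum>i\<in>I. ?W * ((1 - \<theta>) * (z i powr a / U) + \<theta> * (z i powr b / V)))"
  proof (rule sum_mono)
    fix i assume i: "i \<in> I"
    show "z i powr ((1 - \<theta>) * a + \<theta> * b) \<le> ?W * ((1 - \<theta>) * (z i powr a / U) + \<theta> * (z i powr b / V))"
    \<comment> \<open>At zero both sides vanish, as \<open>0 powr x = 0\<close> for every
      exponent.\<close>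
    proof (cases "z i = 0")
      case False
      then have zi: "z i > 0" using z[OF i] by simp
      have "(z i powr a / U) powr (1 - \<theta>) * (z i powr b / V) powr \<theta>
          \<le> (1 - \<theta>) * (z i powr a / U) + \<theta> * (z i powr b / V)"
        by (rule Youngs_inequality_0) (use zi U V \<theta> in auto)
      then have "?W * ((z i powr a / U) powr (1 - \<theta>) * (z i powr b / V) powr \<theta>)
          \<le> ?W * ((1 - \<theta>) * (z i powr a / U) + \<theta> * (z i powr b / V))"
        by (intro mult_left_mono) auto
      moreover have "?W * ((z i powr a / U) powr (1 - \<theta>) * (z i powr b / V) powr \<theta>)
          = z i powr ((1 - \<theta>) * a + \<theta> * b)"
        using zi U V by (simp add: powr_divide powr_powr powr_add mult.commute[of a] mult.commute[of b])
      ultimately show ?thesis by simp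
    qed simp
  qed
  also have "\<dots> = ?W * ((1 - \<theta>) * ((\<Sum>i\<in>I. z i powr a) / U) + \<theta> * ((\<Sum>i\<in>I. z i powr b) / V))"
    by (simp only: sum_distrib_left[symmetric] sum.distrib sum_divide_distrib)
  also have "\<dots> \<le> ?W * ((1 - \<theta>) * 1 + \<theta> * 1)"
    using U V \<theta> by (intro mult_left_mono add_mono) auto
  finally show ?thesis by simp
qed

lemma one_plus_ln_powr_le:
  fixes k e :: real
  assumes "k \<ge> 0" "e > 0"
  shows "\<exists>c>0. \<forall>x\<ge>1. (1 + ln x) powr k \<le> c * x powr e"
proof -
  \<comment> \<open>The denominator \<open>k + 1\<close> keeps \<open>d\<close> defined at
    \<open>k = 0\<close> and still gives \<open>d * k \<le> e\<close>.\<close>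
  define d where "d = e / (k + 1)"
  have d: "d > 0" using assms by (simp add: d_def)
  have dk: "d * k \<le> e" using assms by (simp add: d_def field_simps)
  have "(1 + ln x) powr k \<le> (1 + 1 / d) powr k * x powr e" if x: "x \<ge> 1" for x :: real
  proof -
    have "ln (x powr d) \<le> x powr d - 1" using x by (intro ln_le_minus_one) auto
    then have "d * ln x \<le> x powr d" using x by (simp add: ln_powr)
    then have "ln x \<le> (1 / d) * x powr d" using d by (simp add: field_simps)
    moreover have "1 \<le> x powr d" using x d by (simp add: ge_one_powr_ge_zero)
    ultimately have "1 + ln x \<le> (1 + 1 / d) * x powr d" by (simp add: distrib_right)
    then have "(1 + ln x) powr k \<le> ((1 + 1 / d) * x powr d) powr k"
      using x assms by (intro powr_mono2) auto
    also have "\<dots> = (1 + 1 / d) powr k * x powr (d * k)"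
      using d x by (simp add: powr_mult powr_powr)
    also have "\<dots> \<le> (1 + 1 / d) powr k * x powr e"
      using x dk by (intro mult_left_mono powr_mono) auto
    finally show ?thesis .
  qed
  moreover have "(1 + 1 / d) powr k > 0"
    using d by (simp add: add_pos_pos less_imp_neq[THEN not_sym])
  ultimately show ?thesis by blast
qed

text \<open>All sums are divided by the pointwise bound \<open>Q\<close>. The exponent
  \<open>2 * \<alpha> + 4 * r\<close> of the logarithm comes from undoing this normalisation and
  from the moment of order \<open>2 * r\<close>.\<close>

lemma Kloosterman_interval_moment_interpolated:
  fixes \<alpha> :: real
  assumes p: "prime p" "p > 2" and r: "1 \<le> r" "r < p"
    and J: "interval_mod p N J" "J \<subseteq> Fp_star p" "N \<le> p" "1 \<le> N"
    and \<alpha>: "1 \<le> \<alpha>" "\<alpha> \<le> 12 * real r / 7"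
  shows "(\<Sum>l\<in>Fp_star p. norm (\<Sum>n\<in>J. Kloosterman p l n) powr (2 * \<alpha>))
         \<le> 2 powr (2 * \<alpha>) * ((4 * 3 ^ (2 * r - 1) * 4 ^ r * (real r ^ r + 2 * real r)) * 64 ^ r)
           * (1 + ln (real p)) powr (2 * \<alpha> + 4 * real r) * real p powr (2 * \<alpha>)
           * real N powr ((12 * real r - 7 * \<alpha>) / (12 * real r - 7))
           * (1 + (real N)\<^sup>2 / real p powr (1 - 1 / real r)) powr (7 * (\<alpha> - 1) / (12 * real r - 7))"
proof -
  define S where "S l = norm (\<Sum>n\<in>J. Kloosterman p l n)" for l
  define C where "C = (4 * 3 ^ (2 * r - 1) * 4 ^ r * (real r ^ r + 2 * real r)) * 64 ^ r"
  define L where "L = 1 + ln (real p)"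
  define X where "X = 1 + (real N)\<^sup>2 / real p powr (1 - 1 / real r)"
  \<comment> \<open>The solution of
    \<open>(1 - \<theta>) * 2 + \<theta> * (24 * r / 7) = 2 * \<alpha>\<close>; the range of
    \<open>\<alpha>\<close> places it in the unit interval.\<close>
  define \<theta> where "\<theta> = 7 * (\<alpha> - 1) / (12 * real r - 7)"
  define Q where "Q = 2 * real p * L"
  have r1: "real r \<ge> 1" using r by simp
  have L: "L \<ge> 1" using p by (simp add: L_def)
  have X: "X \<ge> 1" by (simp add: X_def)
  have Q: "Q > 0" using L p by (simp add: Q_def)
  have r7: "12 * real r - 7 > 0" using r1 by linarith
  have \<theta>: "0 \<le> \<theta>" "\<theta> \<le> 1" using \<alpha> r7 by (auto simp: \<theta>_def divide_le_eq_1)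
  have \<theta>': "1 - \<theta> = (12 * real r - 7 * \<alpha>) / (12 * real r - 7)"
    using r7 by (simp add: \<theta>_def field_simps)
  have exp: "(1 - \<theta>) * 2 + \<theta> * (24 * real r / 7) = 2 * \<alpha>"
  proof -
    have "\<theta> * (12 * real r - 7) = 7 * (\<alpha> - 1)" using r7 by (simp add: \<theta>_def)
    moreover have "(1 - \<theta>) * 2 + \<theta> * (24 * real r / 7) = 2 + 2 / 7 * (\<theta> * (12 * real r - 7))"
      by (simp add: field_simps)
    ultimately show ?thesis by simp
  qed
  have C: "C \<ge> 1"
  proof -
    have "0 \<le> real r ^ r" by simp
    then have "1 \<le> real r ^ r + 2 * real r" using r1 by linarith
    then show ?thesis unfolding C_def by (intro mult_ge1_I one_le_power) auto
  qed
  have z1: "0 \<le> S l / Q" "S l / Q \<le> 1" for l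
    using norm_Kloosterman_interval_le[OF p J(1,3), of l] Q by (auto simp: S_def Q_def L_def)
  have "card J \<le> N"
  proof -
    obtain a where "J = (\<lambda>k. k mod int p) ` {a + 1..a + int N}"
      using J(1) by (auto simp: interval_mod_def)
    then show ?thesis using card_image_le[of "{a + 1..a + int N}" "\<lambda>k. k mod int p"] by simp
  qed
  then have "(\<Sum>l\<in>Fp_star p. (S l)\<^sup>2) \<le> (real p)\<^sup>2 * real N"
    unfolding S_def by (intro order_trans[OF Kloosterman_interval_second_moment[OF p J(2)]] mult_left_mono) auto
  \<comment> \<open>Since \<open>p \<le> Q\<close>, dividing by powers of \<open>Q\<close> removes
    all powers of \<open>p\<close> from the moments.\<close>
  also have "\<dots> \<le> Q\<^sup>2 * real N"
  proof (intro mult_right_mono power_mono)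
    have "real p * 1 \<le> (2 * real p) * L" using L by (intro mult_mono) auto
    then show "real p \<le> Q" by (simp add: Q_def)
  qed auto
  finally have "(\<Sum>l\<in>Fp_star p. (S l)\<^sup>2) / Q\<^sup>2 \<le> real N" using Q by (simp add: divide_le_eq mult.commute)
  then have U: "(\<Sum>l\<in>Fp_star p. (S l / Q) powr 2) \<le> real N"
    using z1 by (simp add: power_divide sum_divide_distrib)
  have "(\<Sum>l\<in>Fp_star p. S l ^ (2 * r)) \<le> C * L ^ (4 * r) * real p ^ (2 * r) * X"
    unfolding S_def C_def L_def X_def by (rule Kloosterman_interval_moment[OF p r J(1,3,4)])
  also have "\<dots> \<le> C * L ^ (4 * r) * Q ^ (2 * r) * X"
  proof (intro mult_right_mono mult_left_mono power_mono)
    have "real p * 1 \<le> (2 * real p) * L" using L by (intro mult_mono) auto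
    then show "real p \<le> Q" by (simp add: Q_def)
  qed (use C L X in auto)
  finally have "(\<Sum>l\<in>Fp_star p. S l ^ (2 * r)) / Q ^ (2 * r) \<le> C * L ^ (4 * r) * X"
    using Q by (simp add: divide_le_eq mult_ac)
  then have "(\<Sum>l\<in>Fp_star p. (S l / Q) ^ (2 * r)) \<le> C * L ^ (4 * r) * X"
    by (simp add: power_divide sum_divide_distrib)
  \<comment> \<open>The normalised values are at most one, so passing from exponent
    \<open>2 * r\<close> to the larger \<open>24 * r / 7\<close> only decreases them.\<close>
  moreover have "(S l / Q) powr (24 * real r / 7) \<le> (S l / Q) ^ (2 * r)" for l
  proof (cases "S l / Q = 0")
    case True
    show ?thesis unfolding True by simp
  next
    case False
    then have pos: "S l / Q > 0" using z1[of l] by linarith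
    have "(S l / Q) powr (24 * real r / 7) \<le> (S l / Q) powr real (2 * r)"
      by (rule powr_mono') (use z1[of l] in auto)
    also have "\<dots> = (S l / Q) ^ (2 * r)" by (rule powr_realpow[OF pos])
    finally show ?thesis .
  qed
  ultimately have V: "(\<Sum>l\<in>Fp_star p. (S l / Q) powr (24 * real r / 7)) \<le> C * L ^ (4 * r) * X"
    by (meson order_trans sum_mono)
  have V0: "C * L ^ (4 * r) \<ge> 1" using C L by (intro mult_ge1_I one_le_power)
  have "(\<Sum>l\<in>Fp_star p. (S l / Q) powr (2 * \<alpha>)) \<le> real N powr (1 - \<theta>) * (C * L ^ (4 * r) * X) powr \<theta>"
    using powr_sum_interpolation[of "Fp_star p" "\<lambda>l. S l / Q", OF z1(1) U _ V _ \<theta>] J(4) V0 X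
    unfolding exp by (smt (verit) mult_pos_pos of_nat_1 of_nat_mono)
  also have "(C * L ^ (4 * r) * X) powr \<theta> = (C * L ^ (4 * r)) powr \<theta> * X powr \<theta>"
    by (rule powr_mult)
  \<comment> \<open>The base is at least one and \<open>\<theta> \<le> 1\<close>, so the constant
    and the logarithms can be made independent of \<open>\<theta>\<close>.\<close>
  also have "(C * L ^ (4 * r)) powr \<theta> \<le> (C * L ^ (4 * r)) powr 1"
    by (rule powr_mono) (use V0 \<theta> in auto)
  also have "\<dots> = C * L powr (4 * real r)"
    using V0 L powr_realpow[of L "4 * r"] by simp
  finally have 1: "(\<Sum>l\<in>Fp_star p. (S l / Q) powr (2 * \<alpha>)) \<le> real N powr (1 - \<theta>) * (C * L powr (4 * real r) * X powr \<theta>)"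
    by (simp add: mult_left_mono mult_right_mono)
  have "(\<Sum>l\<in>Fp_star p. S l powr (2 * \<alpha>)) = Q powr (2 * \<alpha>) * (\<Sum>l\<in>Fp_star p. (S l / Q) powr (2 * \<alpha>))"
    unfolding sum_distrib_left
    by (intro sum.cong refl) (use Q in \<open>simp add: S_def flip: powr_mult\<close>)
  also have "\<dots> \<le> Q powr (2 * \<alpha>) * (real N powr (1 - \<theta>) * (C * L powr (4 * real r) * X powr \<theta>))"
    by (intro mult_left_mono 1) auto
  also have "Q powr (2 * \<alpha>) = 2 powr (2 * \<alpha>) * real p powr (2 * \<alpha>) * L powr (2 * \<alpha>)"
    using L by (simp add: Q_def powr_mult)
  also have "2 powr (2 * \<alpha>) * real p powr (2 * \<alpha>) * L powr (2 * \<alpha>) * (real N powr (1 - \<theta>) * (C * L powr (4 * real r) * X powr \<theta>))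
     = 2 powr (2 * \<alpha>) * C * (L powr (2 * \<alpha> + 4 * real r)) * real p powr (2 * \<alpha>) * real N powr (1 - \<theta>) * X powr \<theta>"
    by (simp only: powr_add mult_ac)
  finally show ?thesis
    unfolding S_def C_def L_def X_def \<theta>' unfolding \<theta>_def .
qed

theorem theorem3p1:
  fixes r :: nat and \<alpha> \<epsilon> :: real
  assumes "r \<ge> 1"
    and "1 \<le> \<alpha>" and "\<alpha> \<le> 12 * real r / 7"
    and "\<epsilon> > 0"
  shows "\<exists>C::real. C > 0 \<and> (\<exists>p\<^sub>0::nat. \<forall>p::nat. \<forall>N::nat. \<forall>J::int set.
           prime p \<longrightarrow> p \<ge> p\<^sub>0 \<longrightarrow>
           interval_mod p N J \<longrightarrow> J \<subseteq> Fp_star p \<longrightarrow>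
           1 \<le> N \<longrightarrow> real N \<le> real p powr (1 - 1 / real r) \<longrightarrow>
           (\<Sum>l\<in>Fp_star p. norm (\<Sum>n\<in>J. Kloosterman p l n) powr (2 * \<alpha>))
             \<le> C * real p powr (2 * \<alpha> + \<epsilon>)
                * real N powr ((12 * real r - 7 * \<alpha>) / (12 * real r - 7))
                * (1 + (real N)\<^sup>2 / real p powr (1 - 1 / real r))
                    powr (7 * (\<alpha> - 1) / (12 * real r - 7)))"
proof -
  define D where "D = 2 powr (2 * \<alpha>) * ((4 * 3 ^ (2 * r - 1) * 4 ^ r * (real r ^ r + 2 * real r)) * 64 ^ r)"
  \<comment> \<open>Every logarithmic loss is absorbed into
    \<open>p powr \<epsilon>\<close>.\<close>
  obtain c where c: "c > 0" "\<And>x. x \<ge> 1 \<Longrightarrow> (1 + ln x) powr (2 * \<alpha> + 4 * real r) \<le> c * x powr \<epsilon>"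
    using one_plus_ln_powr_le[of "2 * \<alpha> + 4 * real r" \<epsilon>] assms by auto
  have D: "D > 0" using assms(1) by (auto simp: D_def intro!: mult_pos_pos add_nonneg_pos)
  have "(\<Sum>l\<in>Fp_star p. norm (\<Sum>n\<in>J. Kloosterman p l n) powr (2 * \<alpha>))
             \<le> (D * c) * real p powr (2 * \<alpha> + \<epsilon>)
                * real N powr ((12 * real r - 7 * \<alpha>) / (12 * real r - 7))
                * (1 + (real N)\<^sup>2 / real p powr (1 - 1 / real r))
                    powr (7 * (\<alpha> - 1) / (12 * real r - 7))"
    if p: "prime p" "p \<ge> r + 3" and J: "interval_mod p N J" "J \<subseteq> Fp_star p"
      and N: "1 \<le> N" "real N \<le> real p powr (1 - 1 / real r)" for p N J
  proof -
    \<comment> \<open>The length condition is used through \<open>N \<le> p\<close>, which makes the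
      residues in \<open>J\<close> distinct.\<close>
    have "real p powr (1 - 1 / real r) \<le> real p powr 1"
      using p by (intro powr_mono) auto
    then have "real N \<le> real p" using N(2) p by simp
    then have Np: "N \<le> p" by simp
    have "(\<Sum>l\<in>Fp_star p. norm (\<Sum>n\<in>J. Kloosterman p l n) powr (2 * \<alpha>))
        \<le> D * (1 + ln (real p)) powr (2 * \<alpha> + 4 * real r) * real p powr (2 * \<alpha>)
           * real N powr ((12 * real r - 7 * \<alpha>) / (12 * real r - 7))
           * (1 + (real N)\<^sup>2 / real p powr (1 - 1 / real r)) powr (7 * (\<alpha> - 1) / (12 * real r - 7))"
      unfolding D_def
      by (rule Kloosterman_interval_moment_interpolated) (use p J N(1) Np assms in auto)
    also have "\<dots> \<le> D * (c * real p powr \<epsilon>) * real p powr (2 * \<alpha>)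
           * real N powr ((12 * real r - 7 * \<alpha>) / (12 * real r - 7))
           * (1 + (real N)\<^sup>2 / real p powr (1 - 1 / real r)) powr (7 * (\<alpha> - 1) / (12 * real r - 7))"
      using p D by (intro mult_right_mono mult_left_mono c) auto
    also have "D * (c * real p powr \<epsilon>) * real p powr (2 * \<alpha>) = (D * c) * real p powr (2 * \<alpha> + \<epsilon>)"
      by (simp only: powr_add mult_ac)
    finally show ?thesis .
  qed
  \<comment> \<open>The threshold \<open>r + 3\<close> guarantees both \<open>p > 2\<close> and
    \<open>r < p\<close>; the latter keeps the multiplicities in the root count nonzero modulo
    \<open>p\<close>.\<close>
  then show ?thesis
    using c(1) D by (intro exI[of _ "D * c"] conjI exI[of _ "r + 3"]) auto
qed

end
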